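(* Let $G$ be an arbitrary group and let $\mathbf{A}=(A,\mu,\alpha)$ be an ergodic system. Then $A^K$ is contained in the fixed point algebra $\{a\in A:\sigma^\mu_t(a)=a\text{ for all }t\in\mathbb{R}\}$ of the modular group $\sigma^\mu$ of $\mu$. Furthermore, $\mu^K:=\mu|_{A^K}$ is then tracial, and $A^K$ is therefore a finite von Neumann algebra.
   Context: A system $\mathbf{A}=(A,\mu,\alpha)$ consists of a von Neumann algebra $A$, a faithful normal state $\mu$ on $A$, and a group homomorphism $\alpha:G\to\mathrm{Aut}(A)$, $g\mapsto\alpha_g$, into the $\ast$-automorphisms of $A$ with $\mu\circ\alpha_g=\mu$ for all $g$ (no continuity is assumed). $\mathbf{A}$ is ergodic if its fixed point algebra $A^\alpha:=\{a\in A:\alpha_g(a)=a\text{ for all }g\in G\}$ equals $\mathbb{C}1_A$. An eigenoperator of $\alpha$ is $u\in A\setminus\{0\}$ for which there is a function $\chi:G\to\mathbb{C}$ with $\alpha_g(u)=\chi(g)u$ for all $g\in G$. $A^K$ is the von Neumann subalgebra of $A$ generated by all eigenoperators of $\alpha$. A state $\mu$ on a von Neumann algebra $A$ is tracial if $\mu(ab)=\mu(ba)$ for all $a,b\in A$. *)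

theory Defs
  imports "HOL-Analysis.Analysis" "HOL-Algebra.Bij"
begin

section \<open>Complex Hilbert spaces\<close>

class scaleC =
  fixes scaleC :: "complex \<Rightarrow> 'a \<Rightarrow> 'a"  (infixr \<open>*\<^sub>C\<close> 75)

text \<open>
  A complex Hilbert space is a complete real inner product space with a compatible complex
  structure: the norm and the topology are those of the underlying real space, whose inner
  product is the real part of the complex one. \<open>cinner\<close> is linear in its first argument.
\<close>

class chilbert_space = banach + real_inner + scaleC +
  fixes cinner :: "'a \<Rightarrow> 'a \<Rightarrow> complex"
  assumes scaleC_add_right: "c *\<^sub>C (x + y) = c *\<^sub>C x + c *\<^sub>C y"
    and scaleC_add_left: "(c + d) *\<^sub>C x = c *\<^sub>C x + d *\<^sub>C x"
    and scaleC_scaleC: "c *\<^sub>C d *\<^sub>C x = (c * d) *\<^sub>C x"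
    and scaleR_scaleC: "r *\<^sub>R x = complex_of_real r *\<^sub>C x"
    and cinner_commute: "cinner x y = cnj (cinner y x)"
    and cinner_add_left: "cinner (x + y) z = cinner x z + cinner y z"
    and cinner_scaleC_left: "cinner (c *\<^sub>C x) y = c * cinner x y"
    and inner_eq_Re_cinner: "inner x y = Re (cinner x y)"

lemma norm_scaleC: "norm (c *\<^sub>C x) = cmod c * norm (x::'a::chilbert_space)"
proof -
  have im: "Im (cinner x x) = 0"
    by (metis cinner_commute complex_cnj_cancel_iff Reals_cnj_iff complex_is_Real_iff)
  have "cinner (c *\<^sub>C x) (c *\<^sub>C x) = (c * cnj c) * cinner x x"
    by (metis cinner_commute cinner_scaleC_left complex_cnj_mult mult.assoc)
  then have "Re (cinner (c *\<^sub>C x) (c *\<^sub>C x)) = (cmod c)\<^sup>2 * Re (cinner x x)"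
    by (simp add: im flip: complex_norm_square of_real_power)
  then show ?thesis
    by (simp add: norm_eq_sqrt_inner inner_eq_Re_cinner real_sqrt_mult)
qed

lemma scaleC_left_commute: "c *\<^sub>C d *\<^sub>C x = d *\<^sub>C c *\<^sub>C (x::'a::chilbert_space)"
  by (simp add: scaleC_scaleC mult.commute)


section \<open>The algebra of bounded operators\<close>

definition bounded_clinear :: "('a::chilbert_space \<Rightarrow> 'b::chilbert_space) \<Rightarrow> bool" where
  "bounded_clinear f \<longleftrightarrow> bounded_linear f \<and> (\<forall>c x. f (c *\<^sub>C x) = c *\<^sub>C f x)"

lemma bounded_linear_scaleC: "bounded_linear ((*\<^sub>C) c :: 'a \<Rightarrow> 'a::chilbert_space)"
  by (rule bounded_linear_intro[where K = "cmod c"])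
    (simp_all add: scaleC_add_right scaleR_scaleC scaleC_left_commute norm_scaleC mult.commute)

lemma scaleC_zero_right: "c *\<^sub>C 0 = (0::'a::chilbert_space)"
  using norm_scaleC[of c "0::'a"] by simp

lemma scaleC_minus_right: "c *\<^sub>C (- x) = - (c *\<^sub>C (x::'a::chilbert_space))"
  using linear_neg[OF bounded_linear.linear[OF bounded_linear_scaleC]] .

lemma scaleC_diff_right: "c *\<^sub>C (x - y) = c *\<^sub>C x - c *\<^sub>C (y::'a::chilbert_space)"
  using linear_diff[OF bounded_linear.linear[OF bounded_linear_scaleC]] .

typedef (overloaded) 'a cblinop = "{T :: 'a::chilbert_space \<Rightarrow> 'a. bounded_clinear T}"
  morphisms op_apply Op
  by (rule exI[of _ "\<lambda>_. 0"]) (simp add: bounded_clinear_def scaleC_zero_right)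

notation op_apply  (infixr \<open>*\<^sub>V\<close> 70)

setup_lifting type_definition_cblinop

instantiation cblinop :: (chilbert_space) "{ring, monoid_mult, scaleC}"
begin

lift_definition zero_cblinop :: "'a cblinop" is "\<lambda>_. 0"
  by (simp add: bounded_clinear_def scaleC_zero_right)

lift_definition one_cblinop :: "'a cblinop" is "\<lambda>x. x"
  by (simp add: bounded_clinear_def)

lift_definition plus_cblinop :: "'a cblinop \<Rightarrow> 'a cblinop \<Rightarrow> 'a cblinop" is "\<lambda>S T x. S x + T x"
  by (simp add: bounded_clinear_def bounded_linear_add scaleC_add_right)

lift_definition uminus_cblinop :: "'a cblinop \<Rightarrow> 'a cblinop" is "\<lambda>T x. - T x"
  by (simp add: bounded_clinear_def bounded_linear_minus scaleC_minus_right)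

lift_definition minus_cblinop :: "'a cblinop \<Rightarrow> 'a cblinop \<Rightarrow> 'a cblinop" is "\<lambda>S T x. S x - T x"
  by (simp add: bounded_clinear_def bounded_linear_sub scaleC_diff_right)

lift_definition times_cblinop :: "'a cblinop \<Rightarrow> 'a cblinop \<Rightarrow> 'a cblinop" is "\<lambda>S T x. S (T x)"
  by (simp add: bounded_clinear_def bounded_linear_compose)

lift_definition scaleC_cblinop :: "complex \<Rightarrow> 'a cblinop \<Rightarrow> 'a cblinop" is "\<lambda>c T x. c *\<^sub>C T x"
  by (auto simp add: bounded_clinear_def scaleC_left_commute
      intro: bounded_linear_compose[OF bounded_linear_scaleC])

instance
  by standard
    (transfer; auto simp: bounded_clinear_def fun_eq_iff algebra_simps
      linear_add[OF bounded_linear.linear])+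

end

definition adj :: "'a::chilbert_space cblinop \<Rightarrow> 'a cblinop" where
  "adj T = (THE T'. \<forall>x y. cinner (T *\<^sub>V x) y = cinner x (T' *\<^sub>V y))"


section \<open>Von Neumann algebras and normal states\<close>

definition commutant :: "'a::chilbert_space cblinop set \<Rightarrow> 'a cblinop set" where
  "commutant M = {T. \<forall>S\<in>M. S * T = T * S}"

definition von_neumann_algebra :: "'a::chilbert_space cblinop set \<Rightarrow> bool" where
  "von_neumann_algebra M \<longleftrightarrow> (\<forall>T\<in>M. adj T \<in> M) \<and> commutant (commutant M) = M"

definition generated_von_neumann_algebra ::
    "'a::chilbert_space cblinop set \<Rightarrow> 'a cblinop set \<Rightarrow> 'a cblinop set" where
  "generated_von_neumann_algebra A X = \<Inter>{N. von_neumann_algebra N \<and> N \<subseteq> A \<and> X \<subseteq> N}"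

text \<open>Finite: the identity is not equivalent to a proper subprojection, i.e.\ every isometry
  in the algebra is unitary.\<close>

definition finite_von_neumann_algebra :: "'a::chilbert_space cblinop set \<Rightarrow> bool" where
  "finite_von_neumann_algebra M \<longleftrightarrow>
     von_neumann_algebra M \<and> (\<forall>v\<in>M. adj v * v = 1 \<longrightarrow> v * adj v = 1)"

text \<open>The \<open>\<sigma>\<close>-weak (ultraweak) topology: the coarsest topology making the functionals
  \<open>T \<mapsto> \<Sum>n. \<langle>T x\<^sub>n, y\<^sub>n\<rangle>\<close> with square summable \<open>x\<close>, \<open>y\<close> continuous.\<close>

definition sigma_weak_topology :: "'a::chilbert_space cblinop topology" where
  "sigma_weak_topology = topology_generated_by
     {(\<lambda>T. \<Sum>n. cinner (T *\<^sub>V x n) (y n)) -` U | (x :: nat \<Rightarrow> 'a) (y :: nat \<Rightarrow> 'a) U.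
        summable (\<lambda>n. (norm (x n))\<^sup>2) \<and> summable (\<lambda>n. (norm (y n))\<^sup>2) \<and> open U}"

text \<open>Functionals on an algebra \<open>M\<close> are functions on the type of all operators of which only the
  values on \<open>M\<close> matter; a restriction to a subalgebra is expressed by changing \<open>M\<close>.\<close>

definition state :: "'a::chilbert_space cblinop set \<Rightarrow> ('a cblinop \<Rightarrow> complex) \<Rightarrow> bool" where
  "state M \<mu> \<longleftrightarrow>
     (\<forall>a\<in>M. \<forall>b\<in>M. \<mu> (a + b) = \<mu> a + \<mu> b) \<and>
     (\<forall>c. \<forall>a\<in>M. \<mu> (c *\<^sub>C a) = c * \<mu> a) \<and>
     (\<forall>a\<in>M. \<mu> (adj a * a) \<in> \<real>\<^sub>\<ge>\<^sub>0) \<and>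
     \<mu> 1 = 1"

definition faithful_state :: "'a::chilbert_space cblinop set \<Rightarrow> ('a cblinop \<Rightarrow> complex) \<Rightarrow> bool" where
  "faithful_state M \<mu> \<longleftrightarrow> (\<forall>a\<in>M. \<mu> (adj a * a) = 0 \<longrightarrow> a = 0)"

definition normal_state :: "'a::chilbert_space cblinop set \<Rightarrow> ('a cblinop \<Rightarrow> complex) \<Rightarrow> bool" where
  "normal_state M \<mu> \<longleftrightarrow> continuous_map (subtopology sigma_weak_topology M) euclidean \<mu>"

definition tracial_state :: "'a::chilbert_space cblinop set \<Rightarrow> ('a cblinop \<Rightarrow> complex) \<Rightarrow> bool" where
  "tracial_state M \<mu> \<longleftrightarrow> state M \<mu> \<and> (\<forall>a\<in>M. \<forall>b\<in>M. \<mu> (a * b) = \<mu> (b * a))"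


section \<open>Systems\<close>

definition star_automorphisms :: "'a::chilbert_space cblinop set \<Rightarrow> ('a cblinop \<Rightarrow> 'a cblinop) set" where
  "star_automorphisms A = {\<theta> \<in> Bij A.
     (\<forall>a\<in>A. \<forall>b\<in>A. \<theta> (a + b) = \<theta> a + \<theta> b \<and> \<theta> (a * b) = \<theta> a * \<theta> b) \<and>
     (\<forall>c. \<forall>a\<in>A. \<theta> (c *\<^sub>C a) = c *\<^sub>C \<theta> a) \<and>
     (\<forall>a\<in>A. \<theta> (adj a) = adj (\<theta> a))}"

definition star_aut_group :: "'a::chilbert_space cblinop set \<Rightarrow> ('a cblinop \<Rightarrow> 'a cblinop) monoid" where
  "star_aut_group A = (BijGroup A)\<lparr>carrier := star_automorphisms A\<rparr>"

definition system ::
    "('g, 'm) monoid_scheme \<Rightarrow> 'a::chilbert_space cblinop set \<Rightarrow> ('a cblinop \<Rightarrow> complex) \<Rightarrow>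
     ('g \<Rightarrow> 'a cblinop \<Rightarrow> 'a cblinop) \<Rightarrow> bool" where
  "system G A \<mu> \<alpha> \<longleftrightarrow>
     von_neumann_algebra A \<and> state A \<mu> \<and> faithful_state A \<mu> \<and> normal_state A \<mu> \<and>
     \<alpha> \<in> hom G (star_aut_group A) \<and>
     (\<forall>g\<in>carrier G. \<forall>a\<in>A. \<mu> (\<alpha> g a) = \<mu> a)"

definition fixed_point_algebra ::
    "'i set \<Rightarrow> 'a::chilbert_space cblinop set \<Rightarrow> ('i \<Rightarrow> 'a cblinop \<Rightarrow> 'a cblinop) \<Rightarrow> 'a cblinop set" where
  "fixed_point_algebra I A \<tau> = {a \<in> A. \<forall>i\<in>I. \<tau> i a = a}"

definition ergodic ::
    "('g, 'm) monoid_scheme \<Rightarrow> 'a::chilbert_space cblinop set \<Rightarrow>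
     ('g \<Rightarrow> 'a cblinop \<Rightarrow> 'a cblinop) \<Rightarrow> bool" where
  "ergodic G A \<alpha> \<longleftrightarrow> fixed_point_algebra (carrier G) A \<alpha> = range (\<lambda>c. c *\<^sub>C 1)"

definition eigenoperators ::
    "('g, 'm) monoid_scheme \<Rightarrow> 'a::chilbert_space cblinop set \<Rightarrow>
     ('g \<Rightarrow> 'a cblinop \<Rightarrow> 'a cblinop) \<Rightarrow> 'a cblinop set" where
  "eigenoperators G A \<alpha> =
     {u \<in> A - {0}. \<exists>chi :: 'g \<Rightarrow> complex. \<forall>g\<in>carrier G. \<alpha> g u = chi g *\<^sub>C u}"

definition eigenoperator_algebra ::
    "('g, 'm) monoid_scheme \<Rightarrow> 'a::chilbert_space cblinop set \<Rightarrow>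
     ('g \<Rightarrow> 'a cblinop \<Rightarrow> 'a cblinop) \<Rightarrow> 'a cblinop set" where
  "eigenoperator_algebra G A \<alpha> = generated_von_neumann_algebra A (eigenoperators G A \<alpha>)"


section \<open>Spectral measures\<close>

definition projection_valued_measure :: "(real set \<Rightarrow> 'k::chilbert_space cblinop) \<Rightarrow> bool" where
  "projection_valued_measure E \<longleftrightarrow>
     (\<forall>B\<in>sets borel. adj (E B) = E B) \<and>
     (\<forall>B\<in>sets borel. \<forall>C\<in>sets borel. E (B \<inter> C) = E B * E C) \<and>
     E UNIV = 1 \<and>
     (\<forall>B :: nat \<Rightarrow> real set. range B \<subseteq> sets borel \<longrightarrow> disjoint_family B \<longrightarrow>
        (\<forall>x. (\<lambda>n. E (B n) *\<^sub>V x) sums (E (\<Union>n. B n) *\<^sub>V x)))"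

text \<open>The measure \<open>B \<mapsto> \<langle>E B x, x\<rangle>\<close>.\<close>

definition spectral_measure :: "(real set \<Rightarrow> 'k::chilbert_space cblinop) \<Rightarrow> 'k \<Rightarrow> real measure" where
  "spectral_measure E x =
     measure_of UNIV (sets borel) (\<lambda>B. ennreal (Re (cinner (E B *\<^sub>V x) x)))"

definition spectral_domain :: "(real set \<Rightarrow> 'k::chilbert_space cblinop) \<Rightarrow> (real \<Rightarrow> complex) \<Rightarrow> 'k set" where
  "spectral_domain E f = {x. integrable (spectral_measure E x) (\<lambda>s. (cmod (f s))\<^sup>2)}"

text \<open>The integral of \<open>f\<close> against the complex measure \<open>B \<mapsto> \<langle>E B x, z\<rangle>\<close>, written out by
  polarization.\<close>

definition spectral_form ::
    "(real set \<Rightarrow> 'k::chilbert_space cblinop) \<Rightarrow> (real \<Rightarrow> complex) \<Rightarrow> 'k \<Rightarrow> 'k \<Rightarrow> complex" where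
  "spectral_form E f x z =
     (\<Sum>k<4. \<i> ^ k * (LINT s|spectral_measure E (x + (\<i> ^ k) *\<^sub>C z). f s)) / 4"

text \<open>Unbounded operators are given by their graphs. The graph of the operator \<open>\<integral> f dE\<close>; since
  the domain is dense, its values are determined by testing against vectors of the domain.\<close>

definition spectral_integral ::
    "(real set \<Rightarrow> 'k::chilbert_space cblinop) \<Rightarrow> (real \<Rightarrow> complex) \<Rightarrow> ('k \<times> 'k) set" where
  "spectral_integral E f =
     {(x, y). x \<in> spectral_domain E f \<and> (\<forall>z\<in>spectral_domain E f. cinner y z = spectral_form E f x z)}"

text \<open>\<open>U t\<close> is \<open>D\<close> to the power \<open>\<i> t\<close>, for a positive injective self-adjoint operator with graph
  \<open>D\<close>. Its spectral measure \<open>E\<close> is concentrated on the positive reals, where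
  \<open>s powr (\<i> t) = cis (t * ln s)\<close>, so the values of \<open>ln\<close> elsewhere are irrelevant.\<close>

definition imaginary_powers :: "('k::chilbert_space \<times> 'k) set \<Rightarrow> (real \<Rightarrow> 'k cblinop) \<Rightarrow> bool" where
  "imaginary_powers D U \<longleftrightarrow>
     (\<exists>E. projection_valued_measure E \<and>
        spectral_integral E complex_of_real = D \<and>
        (\<forall>t. spectral_integral E (\<lambda>s. cis (t * ln s)) = {(x, U t *\<^sub>V x) | x. True}))"


section \<open>The modular group\<close>

definition gns_representation ::
    "'a::chilbert_space cblinop set \<Rightarrow> ('a cblinop \<Rightarrow> complex) \<Rightarrow>
     ('a cblinop \<Rightarrow> 'k::chilbert_space cblinop) \<Rightarrow> 'k \<Rightarrow> bool" where
  "gns_representation A \<mu> \<pi> \<Omega> \<longleftrightarrow>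
     (\<forall>a\<in>A. \<forall>b\<in>A. \<pi> (a + b) = \<pi> a + \<pi> b \<and> \<pi> (a * b) = \<pi> a * \<pi> b) \<and>
     (\<forall>c. \<forall>a\<in>A. \<pi> (c *\<^sub>C a) = c *\<^sub>C \<pi> a) \<and>
     (\<forall>a\<in>A. \<pi> (adj a) = adj (\<pi> a)) \<and>
     \<pi> 1 = 1 \<and>
     closure ((\<lambda>a. \<pi> a *\<^sub>V \<Omega>) ` A) = UNIV \<and>
     (\<forall>a\<in>A. \<mu> a = cinner (\<pi> a *\<^sub>V \<Omega>) \<Omega>)"

text \<open>The Tomita operator \<open>S\<close>: the closure of the antilinear map \<open>\<pi> a \<Omega> \<mapsto> \<pi> a\<^sup>* \<Omega>\<close>.\<close>

definition tomita_operator ::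
    "'a::chilbert_space cblinop set \<Rightarrow> ('a cblinop \<Rightarrow> 'k::chilbert_space cblinop) \<Rightarrow> 'k \<Rightarrow> ('k \<times> 'k) set" where
  "tomita_operator A \<pi> \<Omega> = closure {(\<pi> a *\<^sub>V \<Omega>, \<pi> (adj a) *\<^sub>V \<Omega>) | a. a \<in> A}"

text \<open>The adjoint of a densely defined antilinear operator: \<open>\<langle>S x, y\<rangle> = \<langle>S\<^sup>* y, x\<rangle>\<close>.\<close>

definition antilinear_adjoint :: "('k::chilbert_space \<times> 'k) set \<Rightarrow> ('k \<times> 'k) set" where
  "antilinear_adjoint S = {(y, z). \<forall>(x, w)\<in>S. cinner w y = cinner z x}"

text \<open>\<open>\<Delta> = S\<^sup>* S\<close>; relational composition \<open>O\<close> applies its left argument first.\<close>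

definition modular_operator ::
    "'a::chilbert_space cblinop set \<Rightarrow> ('a cblinop \<Rightarrow> 'k::chilbert_space cblinop) \<Rightarrow> 'k \<Rightarrow> ('k \<times> 'k) set" where
  "modular_operator A \<pi> \<Omega> = tomita_operator A \<pi> \<Omega> O antilinear_adjoint (tomita_operator A \<pi> \<Omega>)"

text \<open>\<open>\<sigma>\<close> is the modular group of \<open>\<mu>\<close>, computed in the GNS representation \<open>(\<pi>, \<Omega>)\<close>:
  \<open>\<sigma> t a = \<pi>\<^sup>-\<^sup>1 (\<Delta>\<^bsup>it\<^esup> \<pi>(a) \<Delta>\<^bsup>-it\<^esup>)\<close>. As \<open>\<mu>\<close> is faithful, \<open>\<pi>\<close> is injective on
  \<open>A\<close>, so this determines \<open>\<sigma>\<close> on \<open>A\<close>; by the uniqueness of the GNS representation the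
  result does not depend on \<open>(\<pi>, \<Omega>)\<close>.\<close>

definition modular_group ::
    "'a::chilbert_space cblinop set \<Rightarrow> ('a cblinop \<Rightarrow> complex) \<Rightarrow>
     ('a cblinop \<Rightarrow> 'k::chilbert_space cblinop) \<Rightarrow> 'k \<Rightarrow> (real \<Rightarrow> 'a cblinop \<Rightarrow> 'a cblinop) \<Rightarrow> bool" where
  "modular_group A \<mu> \<pi> \<Omega> \<sigma> \<longleftrightarrow>
     gns_representation A \<mu> \<pi> \<Omega> \<and>
     (\<exists>U. imaginary_powers (modular_operator A \<pi> \<Omega>) U \<and>
        (\<forall>t. \<forall>a\<in>A. \<sigma> t a \<in> A \<and> \<pi> (\<sigma> t a) = U t * \<pi> a * U (- t)))"

end

theory Submission
  imports Defs
begin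

text \<open>
  Let \<open>u\<close> be an eigenoperator. By faithfulness and invariance of \<open>\<mu>\<close> its eigenvalues have modulus
  one, so \<open>u\<^sup>* u\<close> is a scalar and \<open>\<phi>(b) = \<mu>(u\<^sup>* b u)\<close> is an invariant normal functional.
  Ergodicity makes \<open>\<phi>\<close> a multiple of \<open>\<mu>\<close>: the \<open>\<sigma>\<close>-weakly compact convex invariant set
  \<open>{c. \<parallel>c\<parallel> \<le> r, \<mu> c = \<mu> a, \<phi> c = \<phi> a}\<close> has a unique element minimising \<open>\<mu>(c\<^sup>* c)\<close>, which is
  therefore invariant, that is, a scalar. Hence \<open>\<mu>(u b) = \<mu>(b u)\<close> for all \<open>b\<close>. The centralizer of \<open>\<mu>\<close>
  is a von Neumann algebra by the double commutant theorem, so it contains \<open>A\<^sup>K\<close>, which gives traciality,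
  and finiteness by faithfulness. For \<open>a\<close> in the centralizer \<open>\<Delta> \<pi>(a)\<Omega> = \<pi>(a)\<Omega>\<close>, hence
  \<open>\<Delta>\<^bsup>it\<^esup> \<pi>(a)\<Omega> = \<pi>(a)\<Omega>\<close> and \<open>\<pi>(\<sigma>\<^sub>t a)\<Omega> = \<pi>(a)\<Omega>\<close>; since \<open>\<Omega>\<close> is separating, \<open>\<sigma>\<^sub>t a = a\<close>.
\<close>

section \<open>Complex Hilbert spaces and bounded operators\<close>

text \<open>\<open>G\<close> carries neither a topology nor an invariant mean, so functionals cannot
  be compared by averaging over the group; the unique minimiser takes the place of the mean. Each
  automorphism must carry the bounded set into itself. A *-automorphism is given only algebraically,
  so its contractivity has to be derived, from the invertibility of \<open>s - a* a\<close>. The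
  function \<open>c \<mapsto> \<mu>(c* c)\<close> need not be \<sigma>-weakly continuous, so its
  sublevel sets are written as intersections of closed half-spaces. Von Neumann algebras are defined
  by the bicommutant, so the centralizer, cut out by \<sigma>-weakly continuous linear equations, is
  recognised as one through a density theorem. Finally, functions of \<open>\<Delta>\<close> are
  given by polarised integrals, so \<open>\<Delta> x = x\<close> must first be turned into the
  statement that the spectral measure of \<open>x\<close> is concentrated at the point 1, where
  \<open>s \<mapsto> s powr (\<i> t)\<close> has the value 1.\<close>

lemma cinner_add_right: "cinner x (y + z) = cinner x y + cinner x (z::'a::chilbert_space)"
  by (metis cinner_add_left cinner_commute complex_cnj_add)

lemma cinner_scaleC_right: "cinner x (c *\<^sub>C y) = cnj c * cinner x (y::'a::chilbert_space)"
  by (metis cinner_commute cinner_scaleC_left complex_cnj_mult)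

lemma cinner_self: "cinner x x = complex_of_real ((norm (x::'a::chilbert_space))\<^sup>2)"
proof -
  have "Im (cinner x x) = 0"
    by (metis cinner_commute Reals_cnj_iff complex_is_Real_iff)
  then show ?thesis
    by (simp add: power2_norm_eq_inner inner_eq_Re_cinner complex_eq_iff)
qed

lemma Re_cinner: "Re (cinner x y) = inner x (y::'a::chilbert_space)"
  by (simp add: inner_eq_Re_cinner)

text \<open>Multiplying \<open>x\<close> by the conjugate phase makes the complex inner product real
  and nonnegative, so the Cauchy-Schwarz inequality of the underlying real space applies.\<close>

lemma cmod_cinner_le: "cmod (cinner x y) \<le> norm x * norm (y::'a::chilbert_space)"
proof (cases "cinner x y = 0")
  case False
  define c where "c = cnj (sgn (cinner x y))"
  have [simp]: "cmod c = 1"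
    using False by (simp add: c_def norm_sgn)
  have "c * cinner x y = complex_of_real (cmod (cinner x y))"
    using False by (simp add: c_def sgn_div_norm scaleR_conv_of_real divide_simps
      flip: complex_norm_square) (simp add: power2_eq_square complex_norm_square[symmetric]
      mult.commute flip: complex_norm_square of_real_mult)
  then have "cmod (cinner x y) = Re (cinner (c *\<^sub>C x) y)"
    by (simp add: cinner_scaleC_left)
  also have "\<dots> \<le> norm (c *\<^sub>C x) * norm y"
    unfolding Re_cinner by (rule norm_cauchy_schwarz)
  finally show ?thesis
    by (simp add: norm_scaleC)
qed simp

lemma bounded_bilinear_cinner:
  "bounded_bilinear (cinner :: 'a::chilbert_space \<Rightarrow> 'a \<Rightarrow> complex)"
proof
  show "\<exists>K. \<forall>a b::'a. norm (cinner a b) \<le> norm a * norm b * K"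
    by (rule exI[of _ 1]) (simp add: cmod_cinner_le)
qed (simp_all add: cinner_add_left cinner_add_right scaleR_scaleC cinner_scaleC_left
      cinner_scaleC_right scaleR_conv_of_real)

interpretation cinner: bounded_bilinear "cinner :: 'a::chilbert_space \<Rightarrow> 'a \<Rightarrow> complex"
  by (rule bounded_bilinear_cinner)

lemma cinner_eqI:
  assumes "\<And>z. cinner x z = cinner y (z::'a::chilbert_space)"
  shows "x = y"
proof -
  have "cinner (x - y) (x - y) = 0"
    by (simp only: cinner.diff_left assms) simp
  then show ?thesis
    by (simp add: cinner_self)
qed

lemma cinner_eqI_right:
  assumes "\<And>z. cinner z x = cinner z (y::'a::chilbert_space)"
  shows "x = y"
  by (rule cinner_eqI) (metis assms cinner_commute)

lemma scaleC_one: "1 *\<^sub>C x = (x::'a::chilbert_space)"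
  by (metis of_real_1 scaleR_one scaleR_scaleC)

lemma scaleC_minus_one: "(-1) *\<^sub>C x = - (x::'a::chilbert_space)"
  by (metis of_real_1 of_real_minus scaleR_minus1_left scaleR_scaleC)

lemma bounded_linear_op_apply: "bounded_linear ((*\<^sub>V) T)"
  using op_apply[of T] by (simp add: bounded_clinear_def)

lemma op_apply_scaleC: "T *\<^sub>V (c *\<^sub>C x) = c *\<^sub>C (T *\<^sub>V x)"
  using op_apply[of T] by (simp add: bounded_clinear_def)

lemmas op_apply_add = linear_add[OF bounded_linear.linear[OF bounded_linear_op_apply]]
  and op_apply_diff = linear_diff[OF bounded_linear.linear[OF bounded_linear_op_apply]]
  and op_apply_0 = linear_0[OF bounded_linear.linear[OF bounded_linear_op_apply]]

lemma cblinop_apply_simps [simp]: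
  "(0::'a::chilbert_space cblinop) *\<^sub>V x = 0" "(1::'a cblinop) *\<^sub>V x = x"
  "(S + T) *\<^sub>V x = S *\<^sub>V x + T *\<^sub>V x" "(S - T) *\<^sub>V x = S *\<^sub>V x - T *\<^sub>V x"
  "(- T) *\<^sub>V x = - (T *\<^sub>V x)" "(S * T) *\<^sub>V x = S *\<^sub>V T *\<^sub>V x" "(c *\<^sub>C T) *\<^sub>V x = c *\<^sub>C (T *\<^sub>V x)"
  by (transfer; simp)+

lemma cblinop_eqI: "(\<And>x. S *\<^sub>V x = T *\<^sub>V x) \<Longrightarrow> S = T"
  by (simp add: op_apply_inject[symmetric] fun_eq_iff)

lemma cblinop_scaleC_simps:
  fixes S T :: "'a::chilbert_space cblinop"
  shows "c *\<^sub>C (S + T) = c *\<^sub>C S + c *\<^sub>C T" "c *\<^sub>C S * T = c *\<^sub>C (S * T)" "S * c *\<^sub>C T = c *\<^sub>C (S * T)"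
    "c *\<^sub>C d *\<^sub>C S = (c * d) *\<^sub>C S" "1 *\<^sub>C S = S" "(c + d) *\<^sub>C S = c *\<^sub>C S + d *\<^sub>C S"
  by (rule cblinop_eqI; simp add: scaleC_add_right scaleC_add_left scaleC_scaleC op_apply_scaleC scaleC_one)+

lemma cblinop_minus_eq: "- S = (-1) *\<^sub>C (S::'a::chilbert_space cblinop)"
  by (rule cblinop_eqI) (simp add: scaleC_minus_one)

lemma cblinop_diff_eq: "S - T = S + (-1) *\<^sub>C (T::'a::chilbert_space cblinop)"
  by (simp flip: cblinop_minus_eq)

lemma cblinop_boundE:
  obtains K where "K \<ge> 0" "\<And>x. norm (T *\<^sub>V x) \<le> K * norm x"
  using bounded_linear.nonneg_bounded[OF bounded_linear_op_apply[of T]] by (metis mult.commute)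

section \<open>Orthogonal projection, Riesz representation and adjoints\<close>

lemma closed_convex_nearest:
  fixes S :: "'a::{banach, real_inner} set"
  assumes "closed S" "convex S" "S \<noteq> {}"
  obtains p where "p \<in> S" "\<And>y. y \<in> S \<Longrightarrow> norm (x - p) \<le> norm (x - y)"
proof -
  define d where "d = (INF y\<in>S. (norm (x - y))\<^sup>2)"
  have bdd: "bdd_below ((\<lambda>y. (norm (x - y))\<^sup>2) ` S)"
    by (rule bdd_belowI[of _ 0]) auto
  have d_le: "d \<le> (norm (x - y))\<^sup>2" if "y \<in> S" for y
    unfolding d_def by (rule cINF_lower[OF bdd that])
  have "\<exists>y\<in>S. (norm (x - y))\<^sup>2 < d + e" if "e > 0" for e
    using cINF_less_iff[OF assms(3) bdd, of "d + e"] that by (simp add: d_def)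
  then have "\<exists>y. y \<in> S \<and> (norm (x - y))\<^sup>2 < d + inverse (Suc n)" for n :: nat
    by (simp add: Bex_def)
  then obtain Y where Y: "\<And>n::nat. Y n \<in> S" "\<And>n::nat. (norm (x - Y n))\<^sup>2 < d + inverse (Suc n)"
    by metis
  \<comment> \<open>The midpoint of \<open>y\<close> and \<open>z\<close> lies in \<open>S\<close>,
    so its squared distance from \<open>x\<close> is at least \<open>d\<close>; the parallelogram
    law turns this into a bound on \<open>y - z\<close>.\<close>
  have par: "(norm (y - z))\<^sup>2 \<le> 2 * ((norm (x - y))\<^sup>2 - d) + 2 * ((norm (x - z))\<^sup>2 - d)"
    if "y \<in> S" "z \<in> S" for y z
  proof -
    have "(1/2) *\<^sub>R y + (1/2) *\<^sub>R z \<in> S"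
      using assms(2) that by (auto simp: convex_def)
    then have "d \<le> (norm (x - ((1/2) *\<^sub>R y + (1/2) *\<^sub>R z)))\<^sup>2"
      by (rule d_le)
    also have "x - ((1/2) *\<^sub>R y + (1/2) *\<^sub>R z) = (1/2) *\<^sub>R ((x - y) + (x - z))"
      by (simp add: algebra_simps flip: scaleR_add_left)
    finally have 1: "4 * d \<le> (norm ((x - y) + (x - z)))\<^sup>2"
      by (simp add: power_divide)
    have "(norm (y - z))\<^sup>2 + (norm ((x - y) + (x - z)))\<^sup>2 = 2 * (norm (x - y))\<^sup>2 + 2 * (norm (x - z))\<^sup>2"
      by (simp add: power2_norm_eq_inner inner_simps inner_commute)
    with 1 show ?thesis by simp
  qed
  \<comment> \<open>Bounded closed sets need not be compact here, so the minimising sequence itself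
    has to converge. An excess below \<open>e^2 / 4\<close> at both indices makes the bound
    \<open>par\<close> smaller than \<open>e^2\<close>.\<close>
  have "Cauchy Y"
  proof (rule metric_CauchyI)
    fix e :: real assume "e > 0"
    then obtain N :: nat where N: "inverse (Suc N) < e\<^sup>2 / 4"
      using reals_Archimedean[of "e\<^sup>2 / 4"] by auto
    show "\<exists>M. \<forall>m\<ge>M. \<forall>n\<ge>M. dist (Y m) (Y n) < e"
    proof (intro exI[of _ N] allI impI)
      fix m n assume "N \<le> m" "N \<le> n"
      have "(norm (x - Y k))\<^sup>2 - d < e\<^sup>2 / 4" if "N \<le> k" for k
      proof -
        have "inverse (real (Suc k)) \<le> inverse (real (Suc N))"
          by (rule le_imp_inverse_le) (use that in simp_all)
        with N have "inverse (real (Suc k)) < e\<^sup>2 / 4"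
          by (rule order.strict_trans1[rotated])
        with Y(2)[of k] show ?thesis
          by argo
      qed
      from this[OF \<open>N \<le> m\<close>] this[OF \<open>N \<le> n\<close>]
      have "(norm (Y m - Y n))\<^sup>2 < 2 * (e\<^sup>2 / 4) + 2 * (e\<^sup>2 / 4)"
        by (intro order.strict_trans1[OF par[OF Y(1)[of m] Y(1)[of n]]] add_strict_mono) simp_all
      then have "(norm (Y m - Y n))\<^sup>2 < e\<^sup>2"
        by simp
      from power2_less_imp_less[OF this less_imp_le[OF \<open>e > 0\<close>]]
      show "dist (Y m) (Y n) < e"
        by (simp only: dist_norm)
    qed
  qed
  then obtain p where p: "Y \<longlonglongrightarrow> p"
    using Cauchy_convergent convergentD by blast
  have "p \<in> S"
    using closed_sequentially[OF assms(1) _ p] Y(1) by simp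
  moreover have "norm (x - p) \<le> norm (x - y)" if "y \<in> S" for y
  proof -
    have "(\<lambda>n. (norm (x - Y n))\<^sup>2) \<longlonglongrightarrow> (norm (x - p))\<^sup>2"
      by (intro tendsto_intros p)
    moreover have "(\<lambda>n. d + inverse (Suc n)) \<longlonglongrightarrow> d + 0"
      by (intro tendsto_intros LIMSEQ_inverse_real_of_nat)
    ultimately have "(norm (x - p))\<^sup>2 \<le> d + 0"
      by (rule LIMSEQ_le) (intro exI[of _ 0] allI impI less_imp_le Y(2))
    also have "\<dots> \<le> (norm (x - y))\<^sup>2"
      using d_le[OF that] by simp
    finally show ?thesis
      by (rule power2_le_imp_le) simp
  qed
  ultimately show ?thesis
    using that by blast
qed

definition closed_csubspace :: "'a::chilbert_space set \<Rightarrow> bool" where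
  "closed_csubspace V \<longleftrightarrow>
     closed V \<and> 0 \<in> V \<and> (\<forall>x\<in>V. \<forall>y\<in>V. x + y \<in> V) \<and> (\<forall>c. \<forall>x\<in>V. c *\<^sub>C x \<in> V)"

lemma closed_csubspace_diff:
  assumes "closed_csubspace V" "x \<in> V" "y \<in> V"
  shows "x - y \<in> V"
proof -
  have "x + (-1) *\<^sub>C y \<in> V"
    using assms by (simp only: closed_csubspace_def)
  then show ?thesis
    by (simp add: scaleC_minus_one)
qed

lemma orthogonal_decomposition:
  fixes V :: "'a::chilbert_space set"
  assumes V: "closed_csubspace V"
  obtains p where "p \<in> V" "\<And>y. y \<in> V \<Longrightarrow> cinner (x - p) y = 0"
proof -
  have "convex V"
    using V by (auto simp: convex_def closed_csubspace_def scaleR_scaleC)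
  then obtain p where p: "p \<in> V" and min: "\<And>y. y \<in> V \<Longrightarrow> norm (x - p) \<le> norm (x - y)"
    using closed_convex_nearest[of V x] V by (auto simp: closed_csubspace_def)
  have "cinner (x - p) y = 0" if y: "y \<in> V" for y
  proof (cases "y = 0")
    case False
    \<comment> \<open>Moving \<open>p\<close> inside \<open>V\<close> by \<open>t c y\<close>
      changes the squared distance by \<open>- 2 t |c|^2 + t^2 |y|^2 |c|^2\<close>. The chosen
      \<open>t\<close> minimises this, the value being \<open>- t |c|^2\<close>, so minimality of
      \<open>p\<close> forces \<open>c = 0\<close>.\<close>
    define w c t where "w = x - p" and "c = cinner w y" and "t = 1 / (norm y)\<^sup>2"
    have "p + (complex_of_real t * c) *\<^sub>C y \<in> V"
      using V p y by (auto simp: closed_csubspace_def)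
    from min[OF this] have "norm w \<le> norm (w - (complex_of_real t * c) *\<^sub>C y)"
      by (simp add: w_def diff_diff_eq)
    then have le: "(norm w)\<^sup>2 \<le> (norm (w - (complex_of_real t * c) *\<^sub>C y))\<^sup>2"
      by (rule power_mono) simp
    have cs: "cinner y w = cnj c" "cinner w y = c" "cinner w w = complex_of_real ((norm w)\<^sup>2)"
      "cinner y y = complex_of_real ((norm y)\<^sup>2)"
      unfolding c_def by (rule cinner_commute, rule refl, rule cinner_self, rule cinner_self)
    have "complex_of_real ((norm (w - (complex_of_real t * c) *\<^sub>C y))\<^sup>2) =
        cinner (w - (complex_of_real t * c) *\<^sub>C y) (w - (complex_of_real t * c) *\<^sub>C y)"
      by (simp add: cinner_self)
    also have "\<dots> = complex_of_real ((norm w)\<^sup>2) - complex_of_real (2 * t) * (c * cnj c)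
        + complex_of_real (t\<^sup>2 * (norm y)\<^sup>2) * (c * cnj c)"
      by (simp add: cinner.diff_left cinner.diff_right cinner_scaleC_left
            cinner_scaleC_right cs) (simp add: algebra_simps power2_eq_square)
    also have "\<dots> = complex_of_real ((norm w)\<^sup>2 - t * (cmod c)\<^sup>2)"
      using False by (simp add: t_def power2_eq_square flip: complex_norm_square)
    finally have "(norm w)\<^sup>2 \<le> (norm w)\<^sup>2 - t * (cmod c)\<^sup>2"
      using le by (simp only: of_real_eq_iff)
    moreover have "t > 0"
      using False by (simp add: t_def)
    ultimately have "(cmod c)\<^sup>2 \<le> 0"
      by (simp add: mult_le_0_iff)
    then show ?thesis
      by (simp add: c_def w_def)
  qed (simp add: cinner.zero_right)
  with p that show ?thesis
    by blast
qed

text \<open>The kernel has codimension one unless \<open>f = 0\<close>. A vector \<open>e\<close>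
  orthogonal to it determines \<open>f\<close>, and the scalar in front of \<open>e\<close> is fixed
  by comparing values at \<open>e\<close>.\<close>

lemma riesz_representation:
  fixes f :: "'a::chilbert_space \<Rightarrow> complex"
  assumes f: "bounded_linear f" and scale: "\<And>c x. f (c *\<^sub>C x) = c * f x"
  obtains z where "\<And>x. f x = cinner x z"
proof (cases "\<forall>x. f x = 0")
  case True
  then show ?thesis
    using that[of 0] by (simp add: cinner.zero_right)
next
  case False
  interpret f: bounded_linear f by fact
  obtain x where x: "f x \<noteq> 0"
    using False by blast
  have "closed {x. f x = 0}"
    by (intro closed_Collect_eq linear_continuous_on f continuous_intros)
  then have "closed_csubspace {x. f x = 0}"
    by (auto simp: closed_csubspace_def f.add f.zero scale)
  then obtain p where p: "f p = 0" and orth: "\<And>y. f y = 0 \<Longrightarrow> cinner (x - p) y = 0"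
    using orthogonal_decomposition[of _ x] by (metis (mono_tags, lifting) mem_Collect_eq)
  define e where "e = x - p"
  have fe: "f e \<noteq> 0"
    using x p by (simp add: e_def f.diff)
  then have e0: "e \<noteq> 0"
    by (metis f.zero)
  have orth': "cinner y e = 0" if "f y = 0" for y
    using orth[OF that] cinner_commute[of y e] by (simp add: e_def)
  have "f y = cinner y ((cnj (f e) / complex_of_real ((norm e)\<^sup>2)) *\<^sub>C e)" for y
  proof -
    have "f (y - (f y / f e) *\<^sub>C e) = 0"
      using fe by (simp add: f.diff scale)
    then have "cinner (y - (f y / f e) *\<^sub>C e) e = 0"
      by (rule orth')
    then have "cinner y e = f y / f e * complex_of_real ((norm e)\<^sup>2)"
      by (simp add: cinner.diff_left cinner_scaleC_left cinner_self)
    then show ?thesis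
      using fe e0 by (simp add: cinner_scaleC_right)
  qed
  then show ?thesis
    using that by blast
qed

text \<open>This serves twice: for the existence of adjoints, and in the compactness proof, where
  limits are first found as forms and then turned back into operators.\<close>

lemma sesquilinear_form_operator:
  fixes B :: "'a::chilbert_space \<Rightarrow> 'a \<Rightarrow> complex"
  assumes add_left: "\<And>x x' y. B (x + x') y = B x y + B x' y"
    and scale_left: "\<And>c x y. B (c *\<^sub>C x) y = c * B x y"
    and add_right: "\<And>x y y'. B x (y + y') = B x y + B x y'"
    and scale_right: "\<And>c x y. B x (c *\<^sub>C y) = cnj c * B x y"
    and bound: "\<And>x y. cmod (B x y) \<le> K * norm x * norm y"
  shows "\<exists>T. \<forall>x y. cinner (T *\<^sub>V x) y = B x y"
proof -
  \<comment> \<open>\<open>B x\<close> is antilinear in \<open>y\<close>, and the Riesz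
    representation concerns linear functionals; hence the conjugate.\<close>
  have "\<exists>z. \<forall>y. cnj (B x y) = cinner y z" for x
  proof -
    have "bounded_linear (\<lambda>y. cnj (B x y))"
      by (rule bounded_linear_intro[where K = "K * norm x"])
        (use bound[of x] in \<open>simp_all add: add_right scaleR_scaleC scale_right scaleR_conv_of_real mult_ac\<close>)
    then show ?thesis
      using riesz_representation[of "\<lambda>y. cnj (B x y)"] scale_right by (metis complex_cnj_cnj complex_cnj_mult)
  qed
  then obtain t where "\<And>x y. cnj (B x y) = cinner y (t x)"
    by metis
  then have t: "cinner (t x) y = B x y" for x y
    by (metis cinner_commute complex_cnj_cnj)
  have add: "t (x + x') = t x + t x'" for x x'
    by (rule cinner_eqI) (simp add: cinner_add_left t add_left)
  have scale: "t (c *\<^sub>C x) = c *\<^sub>C t x" for c x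
    by (rule cinner_eqI) (simp add: cinner_scaleC_left t scale_left)
  have le: "norm (t x) \<le> norm x * K" for x
  proof (cases "t x = 0")
    case True
    have "0 \<le> K * norm x * norm x"
      using bound[of x x] norm_ge_zero order_trans by blast
    then show ?thesis
      using True by (cases "x = 0") (auto simp: mult.assoc zero_le_mult_iff mult_le_0_iff)
  next
    case False
    have "norm (t x) * norm (t x) = cmod (cinner (t x) (t x))"
      by (simp add: cinner_self power2_eq_square norm_mult)
    also have "\<dots> \<le> K * norm x * norm (t x)"
      unfolding t by (rule bound)
    finally show ?thesis
      using False by (simp add: mult.commute)
  qed
  have "bounded_clinear t"
    using bounded_linear_intro[of t K] add scale le
    by (simp add: bounded_clinear_def scaleR_scaleC)
  then have "(*\<^sub>V) (Op t) = t"
    by (simp add: Op_inverse)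
  then show ?thesis
    by (intro exI[of _ "Op t"]) (simp add: t)
qed

text \<open>\<open>adj\<close> is a definite description, so nothing is known about it before an
  adjoint has been constructed, here from the form \<open>\<langle>x, T y\<rangle>\<close>, and
  shown to be unique.\<close>

lemma cinner_adj_right: "cinner (T *\<^sub>V x) y = cinner x (adj T *\<^sub>V y)"
  for T :: "'a::chilbert_space cblinop"
proof -
  obtain K where K: "K \<ge> 0" "\<And>x. norm (T *\<^sub>V x) \<le> K * norm x"
    using cblinop_boundE by blast
  have "\<exists>T'. \<forall>x y. cinner (T' *\<^sub>V x) y = cinner x (T *\<^sub>V y)"
  proof (rule sesquilinear_form_operator[of "\<lambda>x y. cinner x (T *\<^sub>V y)" K])
    fix x y
    have "cmod (cinner x (T *\<^sub>V y)) \<le> norm x * norm (T *\<^sub>V y)"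
      by (rule cmod_cinner_le)
    also have "\<dots> \<le> norm x * (K * norm y)"
      by (intro mult_left_mono K norm_ge_zero)
    finally show "cmod (cinner x (T *\<^sub>V y)) \<le> K * norm x * norm y"
      by (simp add: mult_ac)
  qed (simp_all add: cinner_add_left cinner_add_right cinner_scaleC_left cinner_scaleC_right
        op_apply_add op_apply_scaleC)
  then obtain T' where T': "\<And>x y. cinner (T' *\<^sub>V x) y = cinner x (T *\<^sub>V y)"
    by blast
  have "\<forall>x y. cinner (T *\<^sub>V x) y = cinner x (T' *\<^sub>V y)"
    using T' by (metis cinner_commute)
  then have "\<forall>x y. cinner (T *\<^sub>V x) y = cinner x (adj T *\<^sub>V y)"
    unfolding adj_def
  proof (rule theI)
    fix T'' assume "\<forall>x y. cinner (T *\<^sub>V x) y = cinner x (T'' *\<^sub>V y)"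
    then show "T'' = T'"
      using \<open>\<forall>x y. cinner (T *\<^sub>V x) y = cinner x (T' *\<^sub>V y)\<close>
      by (intro cblinop_eqI cinner_eqI_right) metis
  qed
  then show ?thesis
    by blast
qed

lemma cinner_adj_left: "cinner (adj T *\<^sub>V x) y = cinner x (T *\<^sub>V y)"
  for T :: "'a::chilbert_space cblinop"
  by (metis cinner_adj_right cinner_commute)

lemma adj_eqI:
  fixes T :: "'a::chilbert_space cblinop"
  assumes "\<And>x y. cinner (T *\<^sub>V x) y = cinner x (T' *\<^sub>V y)"
  shows "adj T = T'"
  by (intro cblinop_eqI cinner_eqI_right) (metis assms cinner_adj_right)

lemma adj_simps [simp]:
  fixes S T :: "'a::chilbert_space cblinop"
  shows "adj (adj T) = T" "adj (S * T) = adj T * adj S" "adj (S + T) = adj S + adj T"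
    "adj (S - T) = adj S - adj T" "adj (c *\<^sub>C T) = cnj c *\<^sub>C adj T"
    "adj (1::'a cblinop) = 1" "adj (0::'a cblinop) = 0"
  by ((rule adj_eqI; simp add: cinner_adj_left), (rule adj_eqI;
      simp add: cinner_adj_right cinner_add_left cinner_add_right cinner.diff_left
      cinner.diff_right cinner_scaleC_left cinner_scaleC_right cinner.zero_left
      cinner.zero_right)+)

text \<open>Linearity of the chosen nearest points comes from uniqueness of the orthogonal
  decomposition: sums and multiples of decompositions are decompositions.\<close>

lemma closed_csubspace_projection:
  fixes V :: "'a::chilbert_space set"
  assumes V: "closed_csubspace V"
  obtains P where "\<And>x. P *\<^sub>V x \<in> V" "\<And>x y. y \<in> V \<Longrightarrow> cinner (x - P *\<^sub>V x) y = 0"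
proof -
  have "\<exists>p. p \<in> V \<and> (\<forall>y\<in>V. cinner (x - p) y = 0)" for x
    using orthogonal_decomposition[OF V] by metis
  then obtain p where p: "\<And>x. p x \<in> V" and orth: "\<And>x y. y \<in> V \<Longrightarrow> cinner (x - p x) y = 0"
    by metis
  have uniq: "q = p x" if "q \<in> V" "\<And>y. y \<in> V \<Longrightarrow> cinner (x - q) y = 0" for x q
  proof -
    have *: "p x - q \<in> V"
      using closed_csubspace_diff[OF V] p that by blast
    then have "cinner (p x - q) (p x - q) = cinner (x - q) (p x - q) - cinner (x - p x) (p x - q)"
      by (simp flip: cinner.diff_left)
    then show ?thesis
      using that(2)[OF *] orth[OF *] by (simp add: cinner_self)
  qed
  have add: "p (x + y) = p x + p y" for x y
  proof (rule uniq[symmetric])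
    show "p x + p y \<in> V" using V p by (simp add: closed_csubspace_def)
    fix z assume "z \<in> V"
    have "x + y - (p x + p y) = (x - p x) + (y - p y)" by simp
    then show "cinner (x + y - (p x + p y)) z = 0"
      using orth[OF \<open>z \<in> V\<close>] by (simp only: cinner_add_left) simp
  qed
  have scale: "p (c *\<^sub>C x) = c *\<^sub>C p x" for c x
  proof (rule uniq[symmetric])
    show "c *\<^sub>C p x \<in> V" using V p by (simp add: closed_csubspace_def)
    fix z assume "z \<in> V"
    then show "cinner (c *\<^sub>C x - c *\<^sub>C p x) z = 0"
      using orth by (simp add: cinner_scaleC_left flip: scaleC_diff_right)
  qed
  have le: "norm (p x) \<le> norm x" for x
  proof (cases "p x = 0")
    case False
    have "cinner (p x) (p x) = cinner x (p x)"
      using orth[OF p, of x x] by (simp add: cinner.diff_left)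
    then have "norm (p x) * norm (p x) \<le> norm x * norm (p x)"
      using cmod_cinner_le[of x "p x"] by (metis cinner_self norm_of_real abs_power2 power2_eq_square abs_norm_cancel abs_mult_self_eq)
    then show ?thesis using False by simp
  qed simp
  have "bounded_clinear p"
    using bounded_linear_intro[of p 1] add scale le by (simp add: bounded_clinear_def scaleR_scaleC)
  then have "(*\<^sub>V) (Op p) = p"
    by (simp add: Op_inverse)
  then show ?thesis
    using that p orth by metis
qed

lemma closed_csubspace_closure:
  fixes V :: "'a::chilbert_space set"
  assumes "0 \<in> V" "\<And>x y. x \<in> V \<Longrightarrow> y \<in> V \<Longrightarrow> x + y \<in> V" "\<And>c x. x \<in> V \<Longrightarrow> c *\<^sub>C x \<in> V"
  shows "closed_csubspace (closure V)"
  unfolding closed_csubspace_def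
proof (intro conjI ballI allI)
  show "x + y \<in> closure V" if "x \<in> closure V" "y \<in> closure V" for x y
  proof -
    obtain X where X: "\<forall>n. X n \<in> V" "X \<longlonglongrightarrow> x"
      using \<open>x \<in> closure V\<close> by (auto simp: closure_sequential)
    obtain Y where Y: "\<forall>n. Y n \<in> V" "Y \<longlonglongrightarrow> y"
      using \<open>y \<in> closure V\<close> by (auto simp: closure_sequential)
    have "(\<forall>n. X n + Y n \<in> V) \<and> (\<lambda>n. X n + Y n) \<longlonglongrightarrow> x + y"
      using X Y assms(2) by (auto intro: tendsto_add)
    then show ?thesis
      unfolding closure_sequential by (rule exI[of _ "\<lambda>n. X n + Y n"])
  qed
  show "0 \<in> closure V"
    using assms(1) closure_subset by blast
  show "c *\<^sub>C x \<in> closure V" if "x \<in> closure V" for c x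
  proof -
    have "(*\<^sub>C) c ` closure V \<subseteq> closure ((*\<^sub>C) c ` V)"
      by (rule closure_bounded_linear_image_subset[OF bounded_linear_scaleC])
    also have "\<dots> \<subseteq> closure V"
      using assms(3) by (intro closure_mono) auto
    finally show ?thesis using that by blast
  qed
qed simp

definition star_subalgebra :: "'a::chilbert_space cblinop set \<Rightarrow> bool" where
  "star_subalgebra M \<longleftrightarrow> 1 \<in> M \<and> (\<forall>S\<in>M. \<forall>T\<in>M. S + T \<in> M \<and> S * T \<in> M) \<and>
     (\<forall>c. \<forall>T\<in>M. c *\<^sub>C T \<in> M) \<and> (\<forall>T\<in>M. adj T \<in> M)"

text \<open>The projection onto the closure of \<open>M x\<close> lies in the commutant of \<open>M\<close>.\<close>

lemma bicommutant_apply_in_closure: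
  fixes M :: "'a::chilbert_space cblinop set"
  assumes M: "star_subalgebra M" and T: "T \<in> commutant (commutant M)"
  shows "T *\<^sub>V x \<in> closure ((\<lambda>S. S *\<^sub>V x) ` M)"
proof -
  define V where "V = closure ((\<lambda>S. S *\<^sub>V x) ` M)"
  have "0 *\<^sub>C 1 \<in> M"
    using M by (simp only: star_subalgebra_def)
  moreover have "(0 *\<^sub>C 1) *\<^sub>V x = 0"
    using norm_scaleC[of 0 x] by simp
  ultimately have "0 \<in> (\<lambda>S. S *\<^sub>V x) ` M"
    by (metis image_eqI)
  moreover have "S *\<^sub>V x + T *\<^sub>V x \<in> (\<lambda>S. S *\<^sub>V x) ` M" if "S \<in> M" "T \<in> M" for S T
    using M that by (intro image_eqI[of _ _ "S + T"]) (auto simp: star_subalgebra_def)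
  moreover have "c *\<^sub>C (S *\<^sub>V x) \<in> (\<lambda>S. S *\<^sub>V x) ` M" if "S \<in> M" for c S
    using M that by (intro image_eqI[of _ _ "c *\<^sub>C S"]) (auto simp: star_subalgebra_def)
  ultimately have V: "closed_csubspace V"
    unfolding V_def by (intro closed_csubspace_closure) auto
  have inv: "S *\<^sub>V y \<in> V" if "S \<in> M" "y \<in> V" for S y
  proof -
    have "(*\<^sub>V) S ` V \<subseteq> closure ((*\<^sub>V) S ` (\<lambda>S. S *\<^sub>V x) ` M)"
      unfolding V_def by (rule closure_bounded_linear_image_subset[OF bounded_linear_op_apply])
    also have "\<dots> \<subseteq> V"
    proof -
      have "S *\<^sub>V R *\<^sub>V x \<in> (\<lambda>S. S *\<^sub>V x) ` M" if "R \<in> M" for R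
        using M \<open>S \<in> M\<close> that by (intro image_eqI[of _ _ "S * R"]) (auto simp: star_subalgebra_def)
      then show ?thesis
        unfolding V_def by (intro closure_mono) auto
    qed
    finally show ?thesis using that by blast
  qed
  obtain P where P: "\<And>x. P *\<^sub>V x \<in> V" "\<And>x y. y \<in> V \<Longrightarrow> cinner (x - P *\<^sub>V x) y = 0"
    using closed_csubspace_projection[OF V] by blast
  have P_eq: "P *\<^sub>V y = q" if "q \<in> V" "\<And>z. z \<in> V \<Longrightarrow> cinner (y - q) z = 0" for y q
  proof -
    have d: "P *\<^sub>V y - q \<in> V"
      using closed_csubspace_diff[OF V] P that by blast
    have "cinner (P *\<^sub>V y - q) (P *\<^sub>V y - q) = cinner (y - q) (P *\<^sub>V y - q) - cinner (y - P *\<^sub>V y) (P *\<^sub>V y - q)"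
      by (simp flip: cinner.diff_left)
    then show ?thesis
      using that(2)[OF d] P(2)[OF d] by (simp add: cinner_self)
  qed
  \<comment> \<open>\<open>V\<close> is invariant under \<open>S\<close> and, as \<open>M\<close> is
    closed under adjoints, under \<open>adj S\<close>. So \<open>S\<close> preserves the orthogonal
    complement too, and commutes with the projection.\<close>
  have "P \<in> commutant M"
    unfolding commutant_def
  proof (intro CollectI ballI cblinop_eqI)
    fix S y assume S: "S \<in> M"
    have "P *\<^sub>V S *\<^sub>V y = S *\<^sub>V P *\<^sub>V y"
    proof (rule P_eq)
      show "S *\<^sub>V P *\<^sub>V y \<in> V"
        using inv S P by blast
      fix z assume "z \<in> V"
      then have "adj S *\<^sub>V z \<in> V"
        using inv S M by (simp add: star_subalgebra_def)
      then show "cinner (S *\<^sub>V y - S *\<^sub>V P *\<^sub>V y) z = 0"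
        using P(2)[of "adj S *\<^sub>V z" y] by (simp add: cinner_adj_right flip: op_apply_diff)
    qed
    then show "(S * P) *\<^sub>V y = (P * S) *\<^sub>V y"
      by simp
  qed
  then have "P * T = T * P"
    using T by (simp add: commutant_def)
  moreover have "x \<in> V"
  proof -
    have "1 *\<^sub>V x \<in> (\<lambda>S. S *\<^sub>V x) ` M"
      using M unfolding star_subalgebra_def by blast
    then show ?thesis
      unfolding V_def using closure_subset by fastforce
  qed
  then have "P *\<^sub>V x = x"
    by (intro P_eq) (simp_all add: cinner.zero_left)
  ultimately have "P *\<^sub>V T *\<^sub>V x = T *\<^sub>V x"
    by (metis cblinop_apply_simps(6))
  then show ?thesis
    using P(1) unfolding V_def by metis
qed

section \<open>Amplification and the double commutant theorem\<close>

lemma summable_norm_power2_add: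
  fixes f g :: "nat \<Rightarrow> 'a::real_inner"
  assumes "summable (\<lambda>n. (norm (f n))\<^sup>2)" "summable (\<lambda>n. (norm (g n))\<^sup>2)"
  shows "summable (\<lambda>n. (norm (f n + g n))\<^sup>2)"
proof (rule summable_comparison_test)
  show "summable (\<lambda>n. 2 * (norm (f n))\<^sup>2 + 2 * (norm (g n))\<^sup>2)"
    by (intro summable_add summable_mult assms)
  have "(norm (x + y))\<^sup>2 \<le> 2 * (norm x)\<^sup>2 + 2 * (norm y)\<^sup>2" for x y :: 'a
  proof -
    have "(norm (x + y))\<^sup>2 + (norm (x - y))\<^sup>2 = 2 * (norm x)\<^sup>2 + 2 * (norm y)\<^sup>2"
      by (simp add: power2_norm_eq_inner inner_simps inner_commute)
    moreover have "(norm (x - y))\<^sup>2 \<ge> 0"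
      by simp
    ultimately show ?thesis
      by linarith
  qed
  then show "\<exists>N. \<forall>n\<ge>N. norm ((norm (f n + g n))\<^sup>2) \<le> 2 * (norm (f n))\<^sup>2 + 2 * (norm (g n))\<^sup>2"
    by simp
qed

lemma summable_norm_mult_norm:
  fixes f g :: "nat \<Rightarrow> 'a::real_normed_vector"
  assumes "summable (\<lambda>n. (norm (f n))\<^sup>2)" "summable (\<lambda>n. (norm (g n))\<^sup>2)"
  shows "summable (\<lambda>n. norm (f n) * norm (g n))"
proof (rule summable_comparison_test)
  show "summable (\<lambda>n. (norm (f n))\<^sup>2 + (norm (g n))\<^sup>2)"
    by (intro summable_add assms)
  have "norm x * norm y \<le> (norm x)\<^sup>2 + (norm y)\<^sup>2" for x y :: 'a
    using sum_squares_bound[of "norm x" "norm y"] mult_nonneg_nonneg[OF norm_ge_zero[of x] norm_ge_zero[of y]]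
    by linarith
  then show "\<exists>N. \<forall>n\<ge>N. norm (norm (f n) * norm (g n)) \<le> (norm (f n))\<^sup>2 + (norm (g n))\<^sup>2"
    by simp
qed

lemma summable_cinner:
  fixes f g :: "nat \<Rightarrow> 'a::chilbert_space"
  assumes "summable (\<lambda>n. (norm (f n))\<^sup>2)" "summable (\<lambda>n. (norm (g n))\<^sup>2)"
  shows "summable (\<lambda>n. cinner (f n) (g n))"
  by (rule summable_comparison_test[OF _ summable_norm_mult_norm[OF assms]]) (simp add: cmod_cinner_le)

lemma summable_norm_scaleC:
  fixes f :: "nat \<Rightarrow> 'a::chilbert_space"
  shows "summable (\<lambda>n. (norm (f n))\<^sup>2) \<Longrightarrow> summable (\<lambda>n. (norm (c *\<^sub>C f n))\<^sup>2)"
  by (simp add: norm_scaleC power_mult_distrib summable_mult)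

lemma summable_norm_op_apply:
  fixes f :: "nat \<Rightarrow> 'a::chilbert_space"
  assumes "summable (\<lambda>n. (norm (f n))\<^sup>2)"
  shows "summable (\<lambda>n. (norm (T *\<^sub>V f n))\<^sup>2)"
proof -
  obtain K where K: "\<And>x. norm (T *\<^sub>V x) \<le> K * norm x"
    using cblinop_boundE by blast
  have "(norm (T *\<^sub>V x))\<^sup>2 \<le> K\<^sup>2 * (norm x)\<^sup>2" for x
    using power_mono[OF K norm_ge_zero, of _ 2] by (simp add: power_mult_distrib)
  then show ?thesis
    by (intro summable_comparison_test[OF _ summable_mult[OF assms, of "K\<^sup>2"]]) simp
qed

section \<open>The Hilbert space of square summable sequences\<close>

typedef (overloaded) 'a ell2 = "{f :: nat \<Rightarrow> 'a::chilbert_space. summable (\<lambda>n. (norm (f n))\<^sup>2)}"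
  morphisms ell2_nth Ell2
  by (rule exI[of _ "\<lambda>_. 0"]) simp

setup_lifting type_definition_ell2

lemma summable_ell2: "summable (\<lambda>n. (norm (ell2_nth x n))\<^sup>2)"
  using ell2_nth[of x] by simp

lemma ell2_eqI: "(\<And>n. ell2_nth x n = ell2_nth y n) \<Longrightarrow> x = y"
  by (simp add: ell2_nth_inject[symmetric] fun_eq_iff)

instantiation ell2 :: (chilbert_space) "{real_vector, scaleC}"
begin

lift_definition zero_ell2 :: "'a ell2" is "\<lambda>_. 0"
  by simp

lift_definition plus_ell2 :: "'a ell2 \<Rightarrow> 'a ell2 \<Rightarrow> 'a ell2" is "\<lambda>f g n. f n + g n"
  by (rule summable_norm_power2_add)

lift_definition uminus_ell2 :: "'a ell2 \<Rightarrow> 'a ell2" is "\<lambda>f n. - f n"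
  by simp

lift_definition minus_ell2 :: "'a ell2 \<Rightarrow> 'a ell2 \<Rightarrow> 'a ell2" is "\<lambda>f g n. f n - g n"
  using summable_norm_power2_add[of _ "\<lambda>n. - _ n"] by simp

lift_definition scaleC_ell2 :: "complex \<Rightarrow> 'a ell2 \<Rightarrow> 'a ell2" is "\<lambda>c f n. c *\<^sub>C f n"
  by (rule summable_norm_scaleC)

lift_definition scaleR_ell2 :: "real \<Rightarrow> 'a ell2 \<Rightarrow> 'a ell2" is "\<lambda>c f n. c *\<^sub>R f n"
  by (simp add: power_mult_distrib summable_mult)

instance
  by standard (transfer; simp add: algebra_simps)+

end

lemma ell2_nth_simps [simp]:
  fixes x y :: "'a::chilbert_space ell2"
  shows "ell2_nth (0::'a ell2) n = 0" "ell2_nth (x + y) n = ell2_nth x n + ell2_nth y n"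
    "ell2_nth (x - y) n = ell2_nth x n - ell2_nth y n" "ell2_nth (- x) n = - ell2_nth x n"
    "ell2_nth (c *\<^sub>C x) n = c *\<^sub>C ell2_nth x n" "ell2_nth (r *\<^sub>R x) n = r *\<^sub>R ell2_nth x n"
  by (transfer; simp)+

instantiation ell2 :: (chilbert_space) real_inner
begin

definition "inner_ell2 x y = (\<Sum>n. inner (ell2_nth x n) (ell2_nth y n))"
definition "norm_ell2 (x::'a ell2) = sqrt (inner x x)"
definition "dist_ell2 (x::'a ell2) y = norm (x - y)"
definition "sgn_ell2 (x::'a ell2) = x /\<^sub>R norm x"
definition "uniformity_ell2 = (INF e\<in>{0<..}. principal {(x::'a ell2, y). dist x y < e})"
definition "open_ell2 (U::'a ell2 set) \<longleftrightarrow> (\<forall>x\<in>U. \<forall>\<^sub>F (x', y) in uniformity. x' = x \<longrightarrow> y \<in> U)"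

instance
proof
  fix x y z :: "'a ell2" and r :: real
  have s: "summable (\<lambda>n. inner (ell2_nth a n) (ell2_nth b n))" for a b :: "'a ell2"
    using summable_Re[OF summable_cinner[OF summable_ell2[of a] summable_ell2[of b]]]
    by (simp add: Re_cinner)
  show "dist x y = norm (x - y)" by (rule dist_ell2_def)
  show "sgn x = x /\<^sub>R norm x" by (rule sgn_ell2_def)
  show "(uniformity :: ('a ell2 \<times> 'a ell2) filter) = (INF e\<in>{0<..}. principal {(x, y). dist x y < e})"
    by (rule uniformity_ell2_def)
  show "open U \<longleftrightarrow> (\<forall>x\<in>U. \<forall>\<^sub>F (x', y) in uniformity. x' = x \<longrightarrow> y \<in> U)" for U :: "'a ell2 set"
    by (rule open_ell2_def)
  show "inner x y = inner y x"
    by (simp add: inner_ell2_def inner_commute)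
  show "inner (x + y) z = inner x z + inner y z"
    by (simp add: inner_ell2_def inner_add_left suminf_add s)
  show "inner (r *\<^sub>R x) y = r * inner x y"
    by (simp add: inner_ell2_def suminf_mult s)
  show "0 \<le> inner x x"
    unfolding inner_ell2_def by (intro suminf_nonneg s) simp
  show "inner x x = 0 \<longleftrightarrow> x = 0"
  proof -
    have "inner x x = 0 \<longleftrightarrow> (\<forall>n. inner (ell2_nth x n) (ell2_nth x n) = 0)"
      unfolding inner_ell2_def by (rule suminf_eq_zero_iff[OF s]) simp
    then show ?thesis
      by (auto intro!: ell2_eqI)
  qed
  show "norm x = sqrt (inner x x)" by (rule norm_ell2_def)
qed

end

lemma norm_ell2_power2: "(norm x)\<^sup>2 = (\<Sum>n. (norm (ell2_nth x n))\<^sup>2)"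
  by (simp add: power2_norm_eq_inner inner_ell2_def)

lemma norm_ell2_nth_le: "norm (ell2_nth x n) \<le> norm x"
proof (rule power2_le_imp_le)
  show "(norm (ell2_nth x n))\<^sup>2 \<le> (norm x)\<^sup>2"
    using sum_le_suminf[OF summable_ell2[of x], of "{n}"] by (simp add: norm_ell2_power2)
qed simp

lemma norm_ell2_le:
  assumes "C \<ge> 0" "\<And>n. (\<Sum>k<n. (norm (ell2_nth x k))\<^sup>2) \<le> C\<^sup>2"
  shows "norm x \<le> C"
proof (rule power2_le_imp_le)
  show "(norm x)\<^sup>2 \<le> C\<^sup>2"
    unfolding norm_ell2_power2 by (rule suminf_le_const[OF summable_ell2 assms(2)])
qed fact

text \<open>A Cauchy sequence converges in each coordinate. Square summability of the limit and
  convergence in norm both follow from a bound on partial sums that is uniform in their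
  length.\<close>

instance ell2 :: (chilbert_space) banach
proof
  fix X :: "nat \<Rightarrow> 'a ell2" assume X: "Cauchy X"
  have nth: "Cauchy (\<lambda>m. ell2_nth (X m) k)" for k
  proof (rule metric_CauchyI)
    fix e :: real assume "e > 0"
    then obtain M where M: "\<And>m n. m \<ge> M \<Longrightarrow> n \<ge> M \<Longrightarrow> dist (X m) (X n) < e"
      using metric_CauchyD[OF X] by metis
    have "dist (ell2_nth (X m) k) (ell2_nth (X n) k) < e" if "m \<ge> M" "n \<ge> M" for m n
      using norm_ell2_nth_le[of "X m - X n" k] M[OF that] by (simp add: dist_norm)
    then show "\<exists>M. \<forall>m\<ge>M. \<forall>n\<ge>M. dist (ell2_nth (X m) k) (ell2_nth (X n) k) < e"
      by blast
  qed
  then have "\<forall>k. \<exists>l. (\<lambda>m. ell2_nth (X m) k) \<longlonglongrightarrow> l"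
    by (simp add: Cauchy_convergent_iff convergent_def)
  then obtain f where f: "\<And>k. (\<lambda>m. ell2_nth (X m) k) \<longlonglongrightarrow> f k"
    by metis
  \<comment> \<open>With only finitely many coordinates the limit over the second index passes
    through the sum.\<close>
  have part: "(\<Sum>k<n. (norm (ell2_nth (X m) k - f k))\<^sup>2) \<le> e\<^sup>2"
    if M: "\<And>m n. m \<ge> M \<Longrightarrow> n \<ge> M \<Longrightarrow> dist (X m) (X n) < e" and m: "m \<ge> M" for e M m n
  proof (rule tendsto_upperbound)
    show "(\<lambda>j. \<Sum>k<n. (norm (ell2_nth (X m) k - ell2_nth (X j) k))\<^sup>2)
        \<longlonglongrightarrow> (\<Sum>k<n. (norm (ell2_nth (X m) k - f k))\<^sup>2)"
      by (intro tendsto_intros f)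
    have "(\<Sum>k<n. (norm (ell2_nth (X m) k - ell2_nth (X j) k))\<^sup>2) \<le> e\<^sup>2" if "j \<ge> M" for j
    proof -
      have "(\<Sum>k<n. (norm (ell2_nth (X m - X j) k))\<^sup>2) \<le> (norm (X m - X j))\<^sup>2"
        unfolding norm_ell2_power2 by (rule sum_le_suminf[OF summable_ell2]) auto
      also have "\<dots> \<le> e\<^sup>2"
        using M[OF m that] by (intro power_mono) (simp_all add: dist_norm)
      finally show ?thesis by simp
    qed
    then show "\<forall>\<^sub>F j in sequentially. (\<Sum>k<n. (norm (ell2_nth (X m) k - ell2_nth (X j) k))\<^sup>2) \<le> e\<^sup>2"
      by (auto simp: eventually_sequentially)
  qed simp
  have "summable (\<lambda>n. (norm (f n))\<^sup>2)"
  proof -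
    obtain M where M: "\<And>m n. m \<ge> M \<Longrightarrow> n \<ge> M \<Longrightarrow> dist (X m) (X n) < 1"
      using metric_CauchyD[OF X, of 1] by auto
    have "summable (\<lambda>n. (norm (ell2_nth (X M) n - f n))\<^sup>2)"
      by (rule summableI_nonneg_bounded[where x = "1\<^sup>2"]) (simp, rule part[OF M], auto)
    from summable_norm_power2_add[OF summable_ell2[of "- X M"], OF this] show ?thesis
      by simp
  qed
  then have fx: "ell2_nth (Ell2 f) = f"
    by (simp add: Ell2_inverse)
  have "X \<longlonglongrightarrow> Ell2 f"
  proof (rule metric_LIMSEQ_I)
    fix e :: real assume "e > 0"
    then obtain M where M: "\<And>m n. m \<ge> M \<Longrightarrow> n \<ge> M \<Longrightarrow> dist (X m) (X n) < e / 2"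
      using metric_CauchyD[OF X, of "e / 2"] by auto
    have "norm (X m - Ell2 f) \<le> e / 2" if "m \<ge> M" for m
      using part[OF M that] \<open>e > 0\<close> by (intro norm_ell2_le) (simp_all add: fx)
    then have "dist (X m) (Ell2 f) < e" if "m \<ge> M" for m
      using that \<open>e > 0\<close> by (fastforce simp: dist_norm)
    then show "\<exists>M. \<forall>m\<ge>M. dist (X m) (Ell2 f) < e"
      by blast
  qed
  then show "convergent X"
    by (rule convergentI)
qed

instantiation ell2 :: (chilbert_space) chilbert_space
begin

definition "cinner_ell2 x y = (\<Sum>n. cinner (ell2_nth x n) (ell2_nth y n))"

instance
proof
  fix x y z :: "'a ell2" and c d :: complex and r :: real
  have s: "summable (\<lambda>n. cinner (ell2_nth a n) (ell2_nth b n))" for a b :: "'a ell2"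
    by (intro summable_cinner summable_ell2)
  show "c *\<^sub>C (x + y) = c *\<^sub>C x + c *\<^sub>C y"
    by (rule ell2_eqI) (simp add: scaleC_add_right)
  show "(c + d) *\<^sub>C x = c *\<^sub>C x + d *\<^sub>C x"
    by (rule ell2_eqI) (simp add: scaleC_add_left)
  show "c *\<^sub>C d *\<^sub>C x = (c * d) *\<^sub>C x"
    by (rule ell2_eqI) (simp add: scaleC_scaleC)
  show "r *\<^sub>R x = complex_of_real r *\<^sub>C x"
    by (rule ell2_eqI) (simp add: scaleR_scaleC)
  show "cinner x y = cnj (cinner y x)"
    using sums_unique[OF sums_cnj[THEN iffD2, OF summable_sums[OF s[of y x]]]]
    by (simp add: cinner_ell2_def flip: cinner_commute)
  show "cinner (x + y) z = cinner x z + cinner y z"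
    by (simp add: cinner_ell2_def cinner_add_left suminf_add s)
  show "cinner (c *\<^sub>C x) y = c * cinner x y"
    by (simp add: cinner_ell2_def cinner_scaleC_left suminf_mult s)
  show "inner x y = Re (cinner x y)"
    using sums_unique[OF sums_Re[OF summable_sums[OF s]], of x y]
    by (simp add: cinner_ell2_def inner_ell2_def inner_eq_Re_cinner)
qed

end

lift_definition ell2_single :: "nat \<Rightarrow> 'a::chilbert_space \<Rightarrow> 'a ell2" is "\<lambda>j x n. if n = j then x else 0"
  by (rule summable_finite[of "{_}"]) auto

lemma cinner_ell2_single_left: "cinner (ell2_single j x) y = cinner x (ell2_nth y j)"
proof -
  have "cinner (ell2_single j x) y = (\<Sum>n\<in>{j}. cinner (ell2_nth (ell2_single j x) n) (ell2_nth y n))"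
    unfolding cinner_ell2_def by (rule suminf_finite) (simp_all add: ell2_single.rep_eq cinner.zero_left)
  then show ?thesis
    by (simp add: ell2_single.rep_eq)
qed

lemma norm_ell2_single: "norm (ell2_single j x) = norm x"
proof -
  have "cinner (ell2_single j x) (ell2_single j x) = cinner x x"
    by (simp add: cinner_ell2_single_left ell2_single.rep_eq)
  then show ?thesis
    by (simp add: norm_eq_sqrt_inner inner_eq_Re_cinner)
qed

lift_definition ell2_map :: "'a::chilbert_space cblinop \<Rightarrow> 'a ell2 \<Rightarrow> 'a ell2" is "\<lambda>T f n. T *\<^sub>V f n"
  by (rule summable_norm_op_apply)

text \<open>The amplification of \<open>T\<close>, that is \<open>T\<close> tensored with the
  identity. If \<open>X\<close> and \<open>Y\<close> are the vectors formed by two square summable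
  sequences, the corresponding \<sigma>-weak functional is the vector functional
  \<open>\<langle>diag_op T X, Y\<rangle>\<close>.\<close>

definition diag_op :: "'a::chilbert_space cblinop \<Rightarrow> 'a ell2 cblinop" where
  "diag_op T = Op (ell2_map T)"

lemma ell2_nth_diag_op [simp]: "ell2_nth (diag_op T *\<^sub>V x) n = T *\<^sub>V ell2_nth x n"
proof -
  obtain K where K: "K \<ge> 0" "\<And>x. norm (T *\<^sub>V x) \<le> K * norm x"
    using cblinop_boundE by blast
  have "norm (ell2_map T x) \<le> norm x * K" for x
  proof (rule norm_ell2_le)
    fix n
    have "(\<Sum>k<n. (norm (ell2_nth (ell2_map T x) k))\<^sup>2) \<le> (\<Sum>k<n. K\<^sup>2 * (norm (ell2_nth x k))\<^sup>2)"
    proof (rule sum_mono)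
      show "(norm (ell2_nth (ell2_map T x) k))\<^sup>2 \<le> K\<^sup>2 * (norm (ell2_nth x k))\<^sup>2" for k
        using power_mono[OF K(2)[of "ell2_nth x k"] norm_ge_zero, of 2]
        by (simp add: ell2_map.rep_eq power_mult_distrib)
    qed
    also have "\<dots> \<le> K\<^sup>2 * (norm x)\<^sup>2"
      unfolding sum_distrib_left[symmetric] norm_ell2_power2
      by (intro mult_left_mono sum_le_suminf summable_ell2) auto
    finally show "(\<Sum>k<n. (norm (ell2_nth (ell2_map T x) k))\<^sup>2) \<le> (norm x * K)\<^sup>2"
      by (simp add: power_mult_distrib mult.commute)
  qed (simp add: K)
  then have "bounded_clinear (ell2_map T)"
    unfolding bounded_clinear_def
    by (intro conjI allI bounded_linear_intro[where K = K] ell2_eqI)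
      (simp_all add: ell2_map.rep_eq op_apply_add op_apply_scaleC scaleR_scaleC)
  then show ?thesis
    by (simp add: diag_op_def Op_inverse ell2_map.rep_eq)
qed

lemma adj_diag_op: "adj (diag_op T) = diag_op (adj T)"
  by (rule adj_eqI) (simp add: cinner_ell2_def cinner_adj_right)

lemma star_subalgebra_diag_op:
  assumes "star_subalgebra M"
  shows "star_subalgebra (diag_op ` M)"
proof -
  have "1 = diag_op 1" "diag_op S + diag_op T = diag_op (S + T)" "diag_op S * diag_op T = diag_op (S * T)"
    "c *\<^sub>C diag_op S = diag_op (c *\<^sub>C S)" for c and S T :: "'a cblinop"
    by (intro cblinop_eqI ell2_eqI; simp)+
  then show ?thesis
    using assms by (auto simp: star_subalgebra_def adj_diag_op)
qed

text \<open>Passing to adjoints replaces a density argument: each coordinate of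
  \<open>adj S y\<close> is tested against vectors supported at that one index.\<close>

lemma op_ell2_eqI:
  fixes S T :: "'a::chilbert_space ell2 cblinop"
  assumes "\<And>j x. S *\<^sub>V ell2_single j x = T *\<^sub>V ell2_single j x"
  shows "S = T"
proof -
  have "adj S *\<^sub>V y = adj T *\<^sub>V y" for y
    by (intro ell2_eqI cinner_eqI_right)
      (simp add: assms cinner_ell2_single_left[symmetric] cinner_adj_right[symmetric])
  then have "adj (adj S) = adj (adj T)"
    by (intro arg_cong[of _ _ adj] cblinop_eqI)
  then show ?thesis
    by simp
qed

text \<open>The operators in the commutant of \<open>diag_op ` M\<close> are the matrices with entries in the commutant
  of \<open>M\<close>.\<close>

lemma diag_op_bicommutant:
  assumes T: "T \<in> commutant (commutant M)"
  shows "diag_op T \<in> commutant (commutant (diag_op ` M))"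
  unfolding commutant_def[of "commutant (diag_op ` M)"]
proof (intro CollectI ballI)
  fix R assume R: "R \<in> commutant (diag_op ` M)"
  have single: "diag_op S *\<^sub>V ell2_single j x = ell2_single j (S *\<^sub>V x)" for S :: "'a cblinop" and j x
    by (rule ell2_eqI) (simp add: ell2_single.rep_eq op_apply_0)
  have entry: "T *\<^sub>V ell2_nth (R *\<^sub>V ell2_single j x) i = ell2_nth (R *\<^sub>V ell2_single j (T *\<^sub>V x)) i" for i j x
  proof -
    \<comment> \<open>The matrix entry of \<open>R\<close> in row \<open>i\<close> and column
      \<open>j\<close>. Amplified operators act coordinatewise, so this entry commutes with
      \<open>M\<close>, and therefore with \<open>T\<close>.\<close>
    define t where "t = (\<lambda>x. ell2_nth (R *\<^sub>V ell2_single j x) i)"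
    obtain K where K: "K \<ge> 0" "\<And>x. norm (R *\<^sub>V x) \<le> K * norm x"
      using cblinop_boundE by blast
    have add: "ell2_single j (x + y) = ell2_single j x + ell2_single j y" for x y :: 'a
      by (rule ell2_eqI) (simp add: ell2_single.rep_eq)
    have scale: "ell2_single j (c *\<^sub>C x) = c *\<^sub>C ell2_single j x" for c and x :: 'a
      by (rule ell2_eqI) (simp add: ell2_single.rep_eq scaleC_zero_right)
    have "norm (t x) \<le> norm x * K" for x
      using order_trans[OF norm_ell2_nth_le K(2)[of "ell2_single j x"], of i]
      by (simp add: t_def norm_ell2_single mult.commute)
    then have "bounded_clinear t"
      unfolding bounded_clinear_def
      by (intro conjI allI bounded_linear_intro[where K = K])
        (simp_all add: t_def add scale op_apply_add op_apply_scaleC scaleR_scaleC)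
    then have t: "(*\<^sub>V) (Op t) = t"
      by (simp add: Op_inverse)
    have "Op t \<in> commutant M"
      unfolding commutant_def
    proof (intro CollectI ballI cblinop_eqI)
      fix S x assume "S \<in> M"
      then have "diag_op S * R = R * diag_op S"
        using R by (simp add: commutant_def)
      then have "diag_op S *\<^sub>V R *\<^sub>V ell2_single j x = R *\<^sub>V diag_op S *\<^sub>V ell2_single j x"
        by (metis cblinop_apply_simps(6))
      then have "ell2_nth (diag_op S *\<^sub>V R *\<^sub>V ell2_single j x) i = ell2_nth (R *\<^sub>V diag_op S *\<^sub>V ell2_single j x) i"
        by simp
      then show "(S * Op t) *\<^sub>V x = (Op t * S) *\<^sub>V x"
        by (simp add: t) (simp add: t_def single)
    qed
    then have "Op t * T = T * Op t"
      using T by (simp add: commutant_def)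
    then have "(Op t * T) *\<^sub>V x = (T * Op t) *\<^sub>V x"
      by simp
    then show ?thesis
      by (simp add: t) (simp add: t_def)
  qed
  show "R * diag_op T = diag_op T * R"
    by (intro op_ell2_eqI ell2_eqI) (simp add: single entry)
qed

text \<open>Every \<sigma>-weak neighbourhood contains one given by finitely many vectors of the
  amplified space and their images. In this form the approximation of image vectors by a subalgebra
  applies.\<close>

lemma sigma_weak_nhd:
  assumes "openin sigma_weak_topology W" "T \<in> W"
  shows "\<exists>F e. finite F \<and> e > 0 \<and> (\<forall>S. (\<forall>x\<in>F. norm (diag_op S *\<^sub>V x - diag_op T *\<^sub>V x) < e) \<longrightarrow> S \<in> W)"
proof -
  have "generate_topology_on {(\<lambda>T. \<Sum>n. cinner (T *\<^sub>V x n) (y n)) -` U | (x :: nat \<Rightarrow> 'a) (y :: nat \<Rightarrow> 'a) U.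
        summable (\<lambda>n. (norm (x n))\<^sup>2) \<and> summable (\<lambda>n. (norm (y n))\<^sup>2) \<and> open U} W"
    using assms(1) unfolding sigma_weak_topology_def openin_topology_generated_by_iff .
  then show ?thesis
    using assms(2)
  proof (induction arbitrary: T)
    case (Int V W)
    from Int.IH(1)[of T] Int.IH(2)[of T] Int.prems obtain F e F' e' where F: "finite F" "e > 0" "\<And>S. (\<forall>x\<in>F. norm (diag_op S *\<^sub>V x - diag_op T *\<^sub>V x) < e) \<Longrightarrow> S \<in> V"
      and F': "finite F'" "e' > 0" "\<And>S. (\<forall>x\<in>F'. norm (diag_op S *\<^sub>V x - diag_op T *\<^sub>V x) < e') \<Longrightarrow> S \<in> W"
      by auto
    show ?case
      by (intro exI[of _ "F \<union> F'"] exI[of _ "min e e'"]) (use F F' in auto)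
  next
    case (UN \<W>)
    then obtain V where V: "V \<in> \<W>" "T \<in> V"
      by blast
    then show ?case
      using UN.IH[OF V] by (elim exE) (intro exI, auto)
  next
    case (Basis V)
    then obtain x y U where V: "V = (\<lambda>T. \<Sum>n. cinner (T *\<^sub>V x n) (y n)) -` U"
      and xy: "summable (\<lambda>n. (norm (x n))\<^sup>2)" "summable (\<lambda>n. (norm (y n))\<^sup>2)" and U: "open U"
      by blast
    have [simp]: "ell2_nth (Ell2 x) = x" "ell2_nth (Ell2 y) = y"
      using xy by (simp_all add: Ell2_inverse)
    have sum: "(\<Sum>n. cinner (S *\<^sub>V x n) (y n)) = cinner (diag_op S *\<^sub>V Ell2 x) (Ell2 y)" for S
      by (simp add: cinner_ell2_def)
    obtain d where d: "d > 0" "\<And>z. dist z (cinner (diag_op T *\<^sub>V Ell2 x) (Ell2 y)) < d \<Longrightarrow> z \<in> U"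
      using U Basis(2) unfolding V sum open_dist by auto
    \<comment> \<open>The added 1 keeps the denominator positive when the second sequence is
      zero.\<close>
    define e where "e = d / (norm (Ell2 y) + 1)"
    have "S \<in> V" if S: "norm (diag_op S *\<^sub>V Ell2 x - diag_op T *\<^sub>V Ell2 x) < e" for S
    proof -
      have "dist (cinner (diag_op S *\<^sub>V Ell2 x) (Ell2 y)) (cinner (diag_op T *\<^sub>V Ell2 x) (Ell2 y))
          = cmod (cinner (diag_op S *\<^sub>V Ell2 x - diag_op T *\<^sub>V Ell2 x) (Ell2 y))"
        by (simp add: dist_norm cinner.diff_left)
      also have "\<dots> \<le> norm (diag_op S *\<^sub>V Ell2 x - diag_op T *\<^sub>V Ell2 x) * norm (Ell2 y)"
        by (rule cmod_cinner_le)
      also have "\<dots> \<le> e * norm (Ell2 y)"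
        using S by (intro mult_right_mono) auto
      also have "\<dots> < d"
        using d(1) norm_ge_zero[of "Ell2 y"] by (simp add: e_def field_simps add_pos_nonneg)
      finally show ?thesis
        unfolding V sum by (auto intro: d(2))
    qed
    moreover have "e > 0"
      using d(1) norm_ge_zero[of "Ell2 y"] by (simp add: e_def add_nonneg_pos)
    ultimately show ?case
      by (intro exI[of _ "{Ell2 x}"] exI[of _ e]) simp
  qed simp
qed

text \<open>Amplifying twice lets a single vector of the doubly amplified space carry the finitely many
  square summable sequences that describe a basic \<open>\<sigma>\<close>-weak neighbourhood.\<close>

lemma bicommutant_sigma_weak_dense:
  fixes M :: "'a::chilbert_space cblinop set"
  assumes M: "star_subalgebra M" and T: "T \<in> commutant (commutant M)"
    and W: "openin sigma_weak_topology W" "T \<in> W"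
  shows "M \<inter> W \<noteq> {}"
proof -
  obtain F e where F: "finite F" "e > 0" "\<And>S. (\<forall>x\<in>F. norm (diag_op S *\<^sub>V x - diag_op T *\<^sub>V x) < e) \<Longrightarrow> S \<in> W"
    using sigma_weak_nhd[OF W] by blast
  obtain f and m :: nat where f: "F = f ` {i. i < m}"
    using finite_imp_nat_seg_image_inj_on[OF F(1)] by blast
  define X where "X = Ell2 (\<lambda>i. if i < m then f i else 0)"
  have X: "ell2_nth X i = f i" if "i < m" for i
  proof -
    have "summable (\<lambda>i. (norm (if i < m then f i else 0))\<^sup>2)"
      by (rule summable_finite[of "{..<m}"]) auto
    then show ?thesis
      using that by (simp add: X_def Ell2_inverse)
  qed
  have "diag_op (diag_op T) *\<^sub>V X \<in> closure ((\<lambda>S. S *\<^sub>V X) ` diag_op ` diag_op ` M)"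
    by (intro bicommutant_apply_in_closure star_subalgebra_diag_op diag_op_bicommutant M T)
  then obtain S where S: "S \<in> M" "norm (diag_op (diag_op S) *\<^sub>V X - diag_op (diag_op T) *\<^sub>V X) < e"
    unfolding closure_approachable using F(2) by (auto simp: dist_norm)
  have "norm (diag_op S *\<^sub>V f i - diag_op T *\<^sub>V f i) < e" if "i < m" for i
    using norm_ell2_nth_le[of "diag_op (diag_op S) *\<^sub>V X - diag_op (diag_op T) *\<^sub>V X" i] S(2) X[OF that]
    by simp
  then have "S \<in> W"
    using F(3) f by blast
  with S(1) show ?thesis
    by blast
qed

section \<open>The ball of a von Neumann algebra, and automorphisms\<close>

lemma topspace_sigma_weak_topology [simp]:
  "topspace (sigma_weak_topology :: 'a::chilbert_space cblinop topology) = UNIV"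
proof -
  have "(\<lambda>T. \<Sum>n. cinner (T *\<^sub>V (\<lambda>_. 0) n) ((\<lambda>_. 0) n)) -` UNIV \<in>
      {(\<lambda>T. \<Sum>n. cinner (T *\<^sub>V x n) (y n)) -` U | (x :: nat \<Rightarrow> 'a) (y :: nat \<Rightarrow> 'a) U.
        summable (\<lambda>n. (norm (x n))\<^sup>2) \<and> summable (\<lambda>n. (norm (y n))\<^sup>2) \<and> open U}"
    by (intro CollectI exI[of _ "\<lambda>_. 0"] exI[of _ UNIV] conjI refl) simp_all
  then show ?thesis
    unfolding sigma_weak_topology_def topology_generated_by_topspace by auto
qed

lemma continuous_map_sigma_weak_functional:
  fixes x y :: "nat \<Rightarrow> 'a::chilbert_space"
  assumes "summable (\<lambda>n. (norm (x n))\<^sup>2)" "summable (\<lambda>n. (norm (y n))\<^sup>2)"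
  shows "continuous_map sigma_weak_topology euclidean (\<lambda>T. \<Sum>n. cinner (T *\<^sub>V x n) (y n))"
  unfolding continuous_map_def
proof (intro conjI allI impI)
  fix U :: "complex set" assume "openin euclidean U"
  then have "openin sigma_weak_topology ((\<lambda>T. \<Sum>n. cinner (T *\<^sub>V x n) (y n)) -` U)"
    unfolding sigma_weak_topology_def using assms by (intro topology_generated_by_Basis) auto
  then show "openin sigma_weak_topology
      {T \<in> topspace sigma_weak_topology. (\<Sum>n. cinner (T *\<^sub>V x n) (y n)) \<in> U}"
    by (simp add: vimage_def)
qed simp

lemma continuous_map_into_sigma_weak:
  fixes f :: "'b \<Rightarrow> 'a::chilbert_space cblinop"
  assumes "\<And>x y. summable (\<lambda>n. (norm (x n))\<^sup>2) \<Longrightarrow> summable (\<lambda>n. (norm (y n))\<^sup>2) \<Longrightarrow>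
    continuous_map X euclidean (\<lambda>p. \<Sum>n. cinner (f p *\<^sub>V x n) (y n))"
  shows "continuous_map X sigma_weak_topology f"
  unfolding sigma_weak_topology_def
proof (rule continuous_on_generated_topo)
  fix V assume "V \<in> {(\<lambda>T. \<Sum>n. cinner (T *\<^sub>V x n) (y n)) -` U | (x :: nat \<Rightarrow> 'a) (y :: nat \<Rightarrow> 'a) U.
        summable (\<lambda>n. (norm (x n))\<^sup>2) \<and> summable (\<lambda>n. (norm (y n))\<^sup>2) \<and> open U}"
  then obtain x y :: "nat \<Rightarrow> 'a" and U where V: "V = (\<lambda>T. \<Sum>n. cinner (T *\<^sub>V x n) (y n)) -` U"
    and xy: "summable (\<lambda>n. (norm (x n))\<^sup>2)" "summable (\<lambda>n. (norm (y n))\<^sup>2)" and U: "open U"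
    by blast
  have "openin X {p \<in> topspace X. (\<Sum>n. cinner (f p *\<^sub>V x n) (y n)) \<in> U}"
    using openin_continuous_map_preimage[OF assms[OF xy]] U by simp
  also have "{p \<in> topspace X. (\<Sum>n. cinner (f p *\<^sub>V x n) (y n)) \<in> U} = f -` V \<inter> topspace X"
    by (auto simp: V)
  finally show "openin X (f -` V \<inter> topspace X)" .
next
  show "f ` topspace X \<subseteq> \<Union> {(\<lambda>T. \<Sum>n. cinner (T *\<^sub>V x n) (y n)) -` U | (x :: nat \<Rightarrow> 'a) (y :: nat \<Rightarrow> 'a) U.
        summable (\<lambda>n. (norm (x n))\<^sup>2) \<and> summable (\<lambda>n. (norm (y n))\<^sup>2) \<and> open U}"
    using topspace_sigma_weak_topology[where 'a = 'a]
    unfolding sigma_weak_topology_def topology_generated_by_topspace by simp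
qed

lemma continuous_map_sigma_weak_mult:
  fixes S R :: "'a::chilbert_space cblinop"
  shows "continuous_map sigma_weak_topology sigma_weak_topology (\<lambda>T. S * T * R)"
proof (rule continuous_map_into_sigma_weak)
  fix x y :: "nat \<Rightarrow> 'a"
  assume "summable (\<lambda>n. (norm (x n))\<^sup>2)" "summable (\<lambda>n. (norm (y n))\<^sup>2)"
  then show "continuous_map sigma_weak_topology euclidean (\<lambda>T. \<Sum>n. cinner ((S * T * R) *\<^sub>V x n) (y n))"
    using continuous_map_sigma_weak_functional[OF summable_norm_op_apply summable_norm_op_apply,
        of x y R "adj S"] by (simp add: cinner_adj_right)
qed

text \<open>An operator of the ball is determined by its form
  \<open>\<langle>T x, y\<rangle>\<close>. These forms are a closed subset of a product of discs,
  compact by Tychonoff's theorem, and the passage back to operators is continuous into the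
  \<sigma>-weak topology.\<close>

lemma compactin_sigma_weak_ball:
  fixes A :: "'a::chilbert_space cblinop set"
  assumes A: "commutant (commutant A) = A" and "r \<ge> 0"
  shows "compactin sigma_weak_topology {T \<in> A. \<forall>x. norm (T *\<^sub>V x) \<le> r * norm x}" (is "compactin _ ?B")
proof -
  \<comment> \<open>Membership in \<open>A\<close> must be a closed condition on forms. As
    \<open>A\<close> is its own bicommutant, it means commuting with each \<open>S\<close> in the
    commutant, and that is the last clause.\<close>
  define F where "F = {k :: 'a \<times> 'a \<Rightarrow> complex.
    (\<forall>x x' y. k (x + x', y) = k (x, y) + k (x', y)) \<and> (\<forall>c x y. k (c *\<^sub>C x, y) = c * k (x, y)) \<and>
    (\<forall>x y y'. k (x, y + y') = k (x, y) + k (x, y')) \<and> (\<forall>c x y. k (x, c *\<^sub>C y) = cnj c * k (x, y)) \<and>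
    (\<forall>x y. cmod (k (x, y)) \<le> r * norm x * norm y) \<and>
    (\<forall>S x y. S \<in> commutant A \<longrightarrow> k (S *\<^sub>V x, y) = k (x, adj S *\<^sub>V y))}"
  have F: "k (x + x', y) = k (x, y) + k (x', y)" "k (c *\<^sub>C x, y) = c * k (x, y)"
    "k (x, y + y') = k (x, y) + k (x, y')" "k (x, c *\<^sub>C y) = cnj c * k (x, y)"
    "cmod (k (x, y)) \<le> r * norm x * norm y"
    "S \<in> commutant A \<Longrightarrow> k (S *\<^sub>V x, y) = k (x, adj S *\<^sub>V y)"
    if "k \<in> F" for k x x' y y' c S
    using that by (simp_all add: F_def)
  have cont: "continuous_on UNIV (\<lambda>k :: 'a \<times> 'a \<Rightarrow> complex. k p)" for p
    by (rule continuous_on_product_coordinates)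
  have "closed F"
    unfolding F_def
    by (intro closed_Collect_conj closed_Collect_all closed_Collect_eq closed_Collect_le
        closed_Collect_imp open_Collect_const continuous_intros cont)
  define D where "D = (\<lambda>p :: 'a \<times> 'a. cball (0::complex) (r * norm (fst p) * norm (snd p)))"
  have "compactin (product_topology (\<lambda>_. euclidean) UNIV) (PiE UNIV D)"
    unfolding compactin_PiE by (simp add: D_def)
  then have "compact (PiE UNIV D)"
    by (simp add: euclidean_product_topology)
  moreover have "F \<subseteq> PiE UNIV D"
    using F(5) by (auto simp: D_def)
  ultimately have F_compact: "compact F"
    using \<open>closed F\<close> by (metis closed_Int_compact inf.absorb1)
  have "\<exists>T. \<forall>x y. cinner (T *\<^sub>V x) y = k (x, y)" if "k \<in> F" for k
    using F[OF that] by (intro sesquilinear_form_operator[where K = r])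
  then obtain J where J: "\<And>k x y. k \<in> F \<Longrightarrow> cinner (J k *\<^sub>V x) y = k (x, y)"
    by metis
  have "J k \<in> ?B" if k: "k \<in> F" for k
  proof -
    have "J k \<in> commutant (commutant A)"
      unfolding commutant_def[of "commutant A"]
    proof (intro CollectI ballI cblinop_eqI cinner_eqI)
      fix S x y assume "S \<in> commutant A"
      then show "cinner ((S * J k) *\<^sub>V x) y = cinner ((J k * S) *\<^sub>V x) y"
        using F(6)[OF k] by (simp add: J[OF k]) (simp add: cinner_adj_right[of S] J[OF k])
    qed
    moreover have "norm (J k *\<^sub>V x) \<le> r * norm x" for x
    proof (cases "J k *\<^sub>V x = 0")
      case False
      have "norm (J k *\<^sub>V x) * norm (J k *\<^sub>V x) = cmod (cinner (J k *\<^sub>V x) (J k *\<^sub>V x))"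
        by (simp add: cinner_self power2_eq_square norm_mult)
      also have "\<dots> \<le> r * norm x * norm (J k *\<^sub>V x)"
        unfolding J[OF k] by (rule F(5)[OF k])
      finally show ?thesis
        using False by simp
    qed (use \<open>r \<ge> 0\<close> in simp)
    ultimately show ?thesis
      using A by simp
  qed
  moreover have "T \<in> J ` F" if T: "T \<in> ?B" for T
  proof -
    define k where "k = (\<lambda>(x, y). cinner (T *\<^sub>V x) y)"
    have "cmod (cinner (T *\<^sub>V x) y) \<le> r * norm x * norm y" for x y
      using T by (intro order_trans[OF cmod_cinner_le] mult_right_mono) auto
    moreover have "cinner (T *\<^sub>V S *\<^sub>V x) y = cinner (T *\<^sub>V x) (adj S *\<^sub>V y)"
      if "S \<in> commutant A" for S x y
    proof -
      have "T * S = S * T"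
        using that T by (simp add: commutant_def)
      then have "T *\<^sub>V S *\<^sub>V x = S *\<^sub>V T *\<^sub>V x"
        by (metis cblinop_apply_simps(6))
      then show ?thesis
        by (simp add: cinner_adj_right[of S])
    qed
    ultimately have k: "k \<in> F"
      by (simp add: F_def k_def op_apply_add op_apply_scaleC cinner_add_left cinner_add_right
          cinner_scaleC_left cinner_scaleC_right)
    have "J k = T"
      by (intro cblinop_eqI cinner_eqI, unfold J[OF k]) (simp add: k_def)
    with k show ?thesis
      by blast
  qed
  ultimately have "?B = J ` F"
    by blast
  moreover have "continuous_map (top_of_set F) sigma_weak_topology J"
  proof (rule continuous_map_into_sigma_weak)
    fix x y :: "nat \<Rightarrow> 'a"
    assume xy: "summable (\<lambda>n. (norm (x n))\<^sup>2)" "summable (\<lambda>n. (norm (y n))\<^sup>2)"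
    \<comment> \<open>Pointwise convergence of forms controls only finite sums. The common bound
      \<open>r\<close> dominates the series on all of \<open>F\<close> at once, so the infinite sum
      is continuous as well.\<close>
    have "uniform_limit F (\<lambda>n k. \<Sum>i<n. k (x i, y i)) (\<lambda>k. \<Sum>i. k (x i, y i)) sequentially"
    proof (rule Weierstrass_m_test)
      show "norm (k (x n, y n)) \<le> r * (norm (x n) * norm (y n))" if "k \<in> F" for n k
        using F(5)[OF that] by (simp add: mult.assoc)
      show "summable (\<lambda>n. r * (norm (x n) * norm (y n)))"
        by (intro summable_mult summable_norm_mult_norm xy)
    qed
    then have "continuous_on F (\<lambda>k. \<Sum>i. k (x i, y i))"
      by (rule uniform_limit_theorem[rotated])
        (auto intro!: always_eventually continuous_on_sum continuous_on_subset[OF cont])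
    then have "continuous_on F (\<lambda>k. \<Sum>n. cinner (J k *\<^sub>V x n) (y n))"
      by (rule continuous_on_eq) (simp add: J)
    then show "continuous_map (top_of_set F) euclidean (\<lambda>k. \<Sum>n. cinner (J k *\<^sub>V x n) (y n))"
      by simp
  qed
  ultimately show ?thesis
    using image_compactin[of "top_of_set F" F sigma_weak_topology J] F_compact
    by (simp add: compactin_subtopology)
qed

section \<open>Inverses in the algebra and contractivity of automorphisms\<close>

lemma star_subalgebra_von_neumann:
  fixes A :: "'a::chilbert_space cblinop set"
  assumes "von_neumann_algebra A"
  shows "star_subalgebra A"
proof -
  \<comment> \<open>The algebra operations are inherited from being a commutant: whatever commutes
    with \<open>N\<close> is closed under sums, products and multiples.\<close>
  define N where "N = commutant A"
  have N: "A = commutant N" and adj: "\<forall>T\<in>A. adj T \<in> A"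
    using assms by (simp_all add: N_def von_neumann_algebra_def)
  have c: "1 \<in> commutant N" "\<And>S T. S \<in> commutant N \<Longrightarrow> T \<in> commutant N \<Longrightarrow> S + T \<in> commutant N"
    "\<And>c T. T \<in> commutant N \<Longrightarrow> c *\<^sub>C T \<in> commutant N"
    by (simp_all add: commutant_def cblinop_scaleC_simps distrib_left distrib_right)
  have m: "S * T \<in> commutant N" if "S \<in> commutant N" "T \<in> commutant N" for S T
    using that unfolding commutant_def by (simp flip: mult.assoc) (simp add: mult.assoc)
  show ?thesis
    using adj unfolding N star_subalgebra_def by (simp add: c m)
qed

text \<open>Solving \<open>s z - T z = y\<close> is the fixed point problem for
  \<open>z \<mapsto> (y + T z) / s\<close>, a contraction with factor \<open>q / s\<close>. This
  takes the place of the Neumann series and stays on the level of vectors.\<close>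

lemma shifted_op_invertible:
  fixes T :: "'a::chilbert_space cblinop"
  assumes T: "\<And>x. norm (T *\<^sub>V x) \<le> q * norm x" and q: "0 \<le> q" "q < s"
  shows "\<exists>R. (complex_of_real s *\<^sub>C 1 - T) * R = 1 \<and> R * (complex_of_real s *\<^sub>C 1 - T) = 1"
proof -
  have s: "s > 0"
    using q by simp
  have uniq: "\<exists>!z. s *\<^sub>R z - T *\<^sub>V z = y" for y
  proof -
    have "\<exists>!z. (y + T *\<^sub>V z) /\<^sub>R s = z"
    proof (rule banach_fix_type)
      show "\<forall>z z'. dist ((y + T *\<^sub>V z) /\<^sub>R s) ((y + T *\<^sub>V z') /\<^sub>R s) \<le> (q / s) * dist z z'"
      proof (intro allI)
        fix z z'
        have "(y + T *\<^sub>V z) /\<^sub>R s - (y + T *\<^sub>V z') /\<^sub>R s = (T *\<^sub>V (z - z')) /\<^sub>R s"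
          by (simp add: op_apply_diff flip: scaleR_diff_right)
        then show "dist ((y + T *\<^sub>V z) /\<^sub>R s) ((y + T *\<^sub>V z') /\<^sub>R s) \<le> (q / s) * dist z z'"
          using T[of "z - z'"] s by (simp add: dist_norm divide_right_mono field_simps)
      qed
    qed (use q in auto)
    moreover have "(y + T *\<^sub>V z) /\<^sub>R s = z \<longleftrightarrow> s *\<^sub>R z - T *\<^sub>V z = y" for z
    proof -
      have "(y + T *\<^sub>V z) /\<^sub>R s = z \<longleftrightarrow> y + T *\<^sub>V z = s *\<^sub>R z"
        using s by (metis divideR_right less_numeral_extra(3))
      then show ?thesis
        by (auto simp: algebra_simps)
    qed
    ultimately show ?thesis
      by simp
  qed
  define R where "R = (\<lambda>y. THE z. s *\<^sub>R z - T *\<^sub>V z = y)"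
  have R: "s *\<^sub>R R y - T *\<^sub>V R y = y" for y
    unfolding R_def by (rule theI'[OF uniq])
  have R_eq: "R y = z" if "s *\<^sub>R z - T *\<^sub>V z = y" for y z
    using uniq R that by blast
  have add: "R (x + y) = R x + R y" for x y
  proof (rule R_eq)
    have "s *\<^sub>R (R x + R y) - T *\<^sub>V (R x + R y) = (s *\<^sub>R R x - T *\<^sub>V R x) + (s *\<^sub>R R y - T *\<^sub>V R y)"
      by (simp add: op_apply_add scaleR_add_right)
    then show "s *\<^sub>R (R x + R y) - T *\<^sub>V (R x + R y) = x + y"
      by (simp only: R)
  qed
  have scale: "R (c *\<^sub>C x) = c *\<^sub>C R x" for c x
  proof (rule R_eq)
    have "s *\<^sub>R (c *\<^sub>C R x) - T *\<^sub>V (c *\<^sub>C R x) = c *\<^sub>C (s *\<^sub>R R x - T *\<^sub>V R x)"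
      by (simp add: op_apply_scaleC scaleC_diff_right scaleR_scaleC scaleC_left_commute)
    then show "s *\<^sub>R (c *\<^sub>C R x) - T *\<^sub>V (c *\<^sub>C R x) = c *\<^sub>C x"
      by (simp only: R)
  qed
  have le: "norm (R y) \<le> norm y * (1 / (s - q))" for y
  proof -
    have "s * norm (R y) = norm (y + T *\<^sub>V R y)"
      using R[of y] s by (metis add.commute diff_add_cancel norm_scaleR abs_of_pos)
    also have "\<dots> \<le> norm y + q * norm (R y)"
      using norm_triangle_ineq[of y "T *\<^sub>V R y"] T[of "R y"] by linarith
    finally show ?thesis
      using q by (simp add: field_simps)
  qed
  have "bounded_clinear R"
    unfolding bounded_clinear_def
    by (intro conjI allI bounded_linear_intro[where K = "1 / (s - q)"]) (simp_all add: add scale le[simplified] scaleR_scaleC)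
  then have R_Op: "(*\<^sub>V) (Op R) = R"
    by (simp add: Op_inverse)
  show ?thesis
  proof (intro exI[of _ "Op R"] conjI cblinop_eqI)
    show "((complex_of_real s *\<^sub>C 1 - T) * Op R) *\<^sub>V x = 1 *\<^sub>V x" for x
      using R[of x] by (simp add: R_Op flip: scaleR_scaleC)
    show "(Op R * (complex_of_real s *\<^sub>C 1 - T)) *\<^sub>V x = 1 *\<^sub>V x" for x
      by (simp add: R_Op flip: scaleR_scaleC) (rule R_eq, rule refl)
  qed
qed

text \<open>Preservation of the unit comes from surjectivity: if \<open>\<theta> a = 1\<close>, then
  \<open>\<theta> 1\<close> is the left factor in \<open>\<theta> (1 * a) = 1\<close>.\<close>

lemma star_automorphism_one:
  assumes "von_neumann_algebra A" "\<theta> \<in> star_automorphisms A"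
  shows "\<theta> 1 = 1"
proof -
  have one: "1 \<in> A"
    using star_subalgebra_von_neumann[OF assms(1)] by (simp add: star_subalgebra_def)
  obtain a where a: "a \<in> A" "\<theta> a = 1"
    using assms(2) one by (auto simp: star_automorphisms_def Bij_def bij_betw_def image_iff) (metis image_iff)
  then have "\<theta> (1 * a) = \<theta> 1 * \<theta> a"
    using assms(2) one unfolding star_automorphisms_def by blast
  with a show ?thesis
    by simp
qed

lemma star_automorphism_closed:
  assumes "\<theta> \<in> star_automorphisms A" "a \<in> A"
  shows "\<theta> a \<in> A"
  using assms by (auto simp: star_automorphisms_def Bij_def bij_betw_def)

text \<open>If \<open>s = \<parallel>\<theta> a\<parallel>\<^sup>2\<close> exceeded \<open>r\<^sup>2\<close>, then \<open>s - a\<^sup>* a\<close> would be invertible in \<open>A\<close>, hence so would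
  \<open>s - \<theta>(a)\<^sup>* \<theta>(a)\<close>, which is not bounded below.\<close>

lemma star_automorphism_contractive:
  fixes A :: "'a::chilbert_space cblinop set"
  assumes A: "von_neumann_algebra A" and \<theta>: "\<theta> \<in> star_automorphisms A" and a: "a \<in> A"
    and bound: "\<And>x. norm (a *\<^sub>V x) \<le> r * norm x" and "r \<ge> 0"
  shows "norm (\<theta> a *\<^sub>V x) \<le> r * norm x"
proof -
  define n where "n = onorm ((*\<^sub>V) (\<theta> a))"
  note bl = bounded_linear_op_apply[of "\<theta> a"]
  have n: "norm (\<theta> a *\<^sub>V x) \<le> n * norm x" "0 \<le> n" for x
    unfolding n_def by (rule onorm[OF bl], rule onorm_pos_le[OF bl])
  have "n \<le> r"
  proof (rule ccontr)
    assume "\<not> n \<le> r"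
    then have nr: "r < n" "0 < n"
      using \<open>r \<ge> 0\<close> by auto
    define s where "s = n\<^sup>2"
    have s: "r\<^sup>2 < s" "0 < s"
      using nr \<open>r \<ge> 0\<close> by (simp_all add: s_def power_strict_mono)
    have adj_bound: "norm (adj T *\<^sub>V x) \<le> c * norm x" if "\<And>x. norm (T *\<^sub>V x) \<le> c * norm x"
      for T :: "'a cblinop" and c x
    proof (cases "adj T *\<^sub>V x = 0")
      case True
      then show ?thesis
        using order_trans[OF norm_ge_zero that] by simp
    next
      case False
      have "norm (adj T *\<^sub>V x) * norm (adj T *\<^sub>V x) = cmod (cinner (adj T *\<^sub>V x) (adj T *\<^sub>V x))"
        by (simp add: cinner_self power2_eq_square norm_mult)
      also have "\<dots> = cmod (cinner x (T *\<^sub>V adj T *\<^sub>V x))"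
        by (simp add: cinner_adj_left)
      also have "\<dots> \<le> norm x * (c * norm (adj T *\<^sub>V x))"
        by (intro order_trans[OF cmod_cinner_le] mult_left_mono that norm_ge_zero)
      finally show ?thesis
        using False by (simp add: mult_ac)
    qed
    note alg = star_subalgebra_von_neumann[OF A, unfolded star_subalgebra_def]
    define b where "b = complex_of_real s *\<^sub>C 1 - adj a * a"
    have "norm ((adj a * a) *\<^sub>V x) \<le> r\<^sup>2 * norm x" for x
      using order_trans[OF adj_bound[OF bound, of "a *\<^sub>V x"] mult_left_mono[OF bound[of x] \<open>r \<ge> 0\<close>]]
      by (simp add: power2_eq_square mult.assoc)
    then obtain c where c: "b * c = 1" "c * b = 1"
      using shifted_op_invertible[of "adj a * a" "r\<^sup>2" s] s unfolding b_def by auto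
    have b: "b \<in> A"
      unfolding b_def cblinop_diff_eq using alg a by blast
    \<comment> \<open>The inverse of \<open>b\<close> stays in the algebra: multiplying
      \<open>b S = S b\<close> by \<open>c\<close> on both sides shows that \<open>c\<close>
      commutes with everything that commutes with \<open>A\<close>.\<close>
    have "c \<in> commutant (commutant A)"
      unfolding commutant_def[of "commutant A"]
    proof (intro CollectI ballI)
      fix S assume "S \<in> commutant A"
      then have "c * (b * S) * c = c * (S * b) * c"
        using b by (simp add: commutant_def)
      then show "S * c = c * S"
        using c by (simp add: mult.assoc) (simp add: mult.assoc[symmetric])
    qed
    then have cA: "c \<in> A"
      using A by (simp add: von_neumann_algebra_def)
    have hom: "\<theta> (a + b) = \<theta> a + \<theta> b" "\<theta> (a * b) = \<theta> a * \<theta> b" "\<theta> (c *\<^sub>C a) = c *\<^sub>C \<theta> a"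
      "\<theta> (adj a) = adj (\<theta> a)" if "a \<in> A" "b \<in> A" for a b c
      using \<theta> that by (simp_all add: star_automorphisms_def)
    have inA: "1 \<in> A" "adj a \<in> A" "adj a * a \<in> A" "complex_of_real s *\<^sub>C 1 \<in> A" "(-1) *\<^sub>C (adj a * a) \<in> A"
      using alg a by blast+
    have \<theta>b: "\<theta> b = complex_of_real s *\<^sub>C 1 - adj (\<theta> a) * \<theta> a"
      unfolding b_def cblinop_diff_eq
      using inA a by (simp add: hom star_automorphism_one[OF A \<theta>])
    have "\<theta> c * \<theta> b = 1"
      using hom(2)[OF cA b] c star_automorphism_one[OF A \<theta>] by simp
    then have inv: "\<theta> c *\<^sub>V \<theta> b *\<^sub>V x = x" for x
      by (metis cblinop_apply_simps(2,6))
    obtain K where K: "K \<ge> 0" "\<And>x. norm (\<theta> c *\<^sub>V x) \<le> K * norm x"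
      using cblinop_boundE by blast
    \<comment> \<open>The factor \<open>2 s\<close> comes from expanding the square of
      \<open>\<theta> b x\<close> and \<open>K^2\<close> from the bounded inverse of
      \<open>\<theta> b\<close>; the added 1 makes \<open>L\<close> positive even for
      \<open>K = 0\<close>.\<close>
    define L where "L = 2 * s * (K\<^sup>2 + 1)"
    have L: "L > 0"
      using s by (simp add: L_def add_nonneg_pos)
    \<comment> \<open>If \<open>\<theta> a\<close> nearly attained its norm at \<open>x\<close>,
      then \<open>\<theta> b x = s x - h\<close> would be small, since
      \<open>norm h \<le> s norm x\<close>. An operator with bounded inverse cannot shrink
      \<open>x\<close> that far.\<close>
    have key: "(norm x)\<^sup>2 \<le> L * (s * (norm x)\<^sup>2 - (norm (\<theta> a *\<^sub>V x))\<^sup>2)" for x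
    proof -
      define h where "h = adj (\<theta> a) *\<^sub>V \<theta> a *\<^sub>V x"
      have "norm h \<le> n * (n * norm x)"
        unfolding h_def using n by (intro order_trans[OF adj_bound[OF n(1)]] mult_left_mono) auto
      then have "(norm h)\<^sup>2 \<le> (s * norm x)\<^sup>2"
        by (intro power_mono) (simp_all add: s_def power2_eq_square mult.assoc)
      moreover have "inner h x = (norm (\<theta> a *\<^sub>V x))\<^sup>2"
        by (simp add: inner_eq_Re_cinner h_def cinner_adj_left cinner_self)
      moreover have "\<theta> b *\<^sub>V x = s *\<^sub>R x - h"
        by (simp add: \<theta>b h_def flip: scaleR_scaleC)
      then have "(norm (\<theta> b *\<^sub>V x))\<^sup>2 = s\<^sup>2 * (norm x)\<^sup>2 - 2 * s * inner h x + (norm h)\<^sup>2"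
        by (simp add: power2_norm_eq_inner inner_simps inner_commute) (simp add: power2_eq_square algebra_simps)
      ultimately have 1: "(norm (\<theta> b *\<^sub>V x))\<^sup>2 \<le> 2 * s * (s * (norm x)\<^sup>2 - (norm (\<theta> a *\<^sub>V x))\<^sup>2)"
        by (simp add: power_mult_distrib power2_eq_square algebra_simps)
      have "(norm x)\<^sup>2 \<le> (K * norm (\<theta> b *\<^sub>V x))\<^sup>2"
        using K(2)[of "\<theta> b *\<^sub>V x"] by (intro power_mono) (simp_all add: inv)
      also have "\<dots> \<le> (K\<^sup>2 + 1) * (norm (\<theta> b *\<^sub>V x))\<^sup>2"
        by (simp add: power_mult_distrib mult_right_mono)
      also have "\<dots> \<le> (K\<^sup>2 + 1) * (2 * s * (s * (norm x)\<^sup>2 - (norm (\<theta> a *\<^sub>V x))\<^sup>2))"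
        by (rule mult_left_mono[OF 1]) simp
      finally show ?thesis
        by (simp add: L_def algebra_simps)
    qed
    \<comment> \<open>\<open>key\<close> lowers the squared bound of \<open>\<theta> a\<close> from
      \<open>s\<close> to \<open>s - 1 / L\<close>, which contradicts \<open>s\<close> being the
      square of its operator norm. The maximum with 0 keeps the argument of the root
      nonnegative.\<close>
    define m where "m = sqrt (max 0 (s - 1 / L))"
    have m: "norm (\<theta> a *\<^sub>V x) \<le> m * norm x" for x
    proof (rule power2_le_imp_le)
      have "(norm (\<theta> a *\<^sub>V x))\<^sup>2 \<le> (s - 1 / L) * (norm x)\<^sup>2"
        using key[of x] L by (simp add: field_simps)
      also have "\<dots> \<le> m\<^sup>2 * (norm x)\<^sup>2"
        unfolding m_def by (intro mult_right_mono) simp_all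
      finally show "(norm (\<theta> a *\<^sub>V x))\<^sup>2 \<le> (m * norm x)\<^sup>2"
        by (simp add: power_mult_distrib)
      show "0 \<le> m * norm x"
        by (simp add: m_def)
    qed
    have "n \<le> m"
      unfolding n_def by (rule onorm_bound) (simp_all add: m m_def[symmetric], simp add: m_def)
    then have "s \<le> m\<^sup>2"
      unfolding s_def using n(2) by (rule power_mono)
    then show False
      using s L by (simp add: m_def max_def split: if_splits)
  qed
  then show ?thesis
    using order_trans[OF n(1) mult_right_mono[OF _ norm_ge_zero]] by blast
qed

section \<open>Faithful normal states and ergodic actions\<close>

locale faithful_normal_state =
  fixes A :: "'a::chilbert_space cblinop set" and \<mu> :: "'a cblinop \<Rightarrow> complex"
  assumes von_neumann: "von_neumann_algebra A" and state: "state A \<mu>"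
    and faithful: "faithful_state A \<mu>" and normal: "normal_state A \<mu>"
begin

lemma star_subalgebra: "star_subalgebra A"
  by (rule star_subalgebra_von_neumann[OF von_neumann])

lemma mem_simps [simp]:
  "1 \<in> A" "a \<in> A \<Longrightarrow> b \<in> A \<Longrightarrow> a + b \<in> A" "a \<in> A \<Longrightarrow> b \<in> A \<Longrightarrow> a * b \<in> A" "a \<in> A \<Longrightarrow> c *\<^sub>C a \<in> A"
  "a \<in> A \<Longrightarrow> adj a \<in> A" "a \<in> A \<Longrightarrow> b \<in> A \<Longrightarrow> a - b \<in> A"
  using star_subalgebra by (simp_all add: star_subalgebra_def cblinop_diff_eq)

lemma state_simps [simp]:
  "a \<in> A \<Longrightarrow> b \<in> A \<Longrightarrow> \<mu> (a + b) = \<mu> a + \<mu> b" "a \<in> A \<Longrightarrow> \<mu> (c *\<^sub>C a) = c * \<mu> a"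
  "a \<in> A \<Longrightarrow> b \<in> A \<Longrightarrow> \<mu> (a - b) = \<mu> a - \<mu> b" "\<mu> 1 = 1"
  using state by (simp_all add: state_def cblinop_diff_eq)

lemma state_square:
  assumes "a \<in> A"
  shows "Re (\<mu> (adj a * a)) \<ge> 0" "Im (\<mu> (adj a * a)) = 0"
  using state assms by (simp_all add: state_def complex_nonneg_Reals_iff)

lemma state_square_le_0:
  assumes "a \<in> A" "Re (\<mu> (adj a * a)) \<le> 0"
  shows "a = 0"
  using faithful assms state_square[of a] by (auto simp: faithful_state_def complex_eq_iff)

text \<open>Symmetry is extracted from positivity: the values at the squares of \<open>a + b\<close>
  and \<open>a + \<i> b\<close> are real, which gives the imaginary and the real part of the
  identity.\<close>

lemma state_hermitian:
  assumes a: "a \<in> A" and b: "b \<in> A"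
  shows "\<mu> (adj b * a) = cnj (\<mu> (adj a * b))"
proof -
  have "Im (\<mu> (adj (a + b) * (a + b))) = 0" "Im (\<mu> (adj (a + \<i> *\<^sub>C b) * (a + \<i> *\<^sub>C b))) = 0"
    using a b by (intro state_square; simp)+
  then show ?thesis
    using a b state_square(2)[OF a] state_square(2)[OF b]
    by (simp add: distrib_left distrib_right cblinop_scaleC_simps complex_eq_iff)
qed

lemma state_adj: "a \<in> A \<Longrightarrow> \<mu> (adj a) = cnj (\<mu> a)"
  using state_hermitian[of 1 a] by simp

lemma continuous_map_state_mult:
  assumes "S \<in> A" "R \<in> A"
  shows "continuous_map (subtopology sigma_weak_topology A) euclidean (\<lambda>T. \<mu> (S * T * R))"
proof -
  have "continuous_map (subtopology sigma_weak_topology A) (subtopology sigma_weak_topology A) (\<lambda>T. S * T * R)"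
    using assms continuous_map_from_subtopology[OF continuous_map_sigma_weak_mult]
    by (auto simp: continuous_map_in_subtopology)
  from continuous_map_compose[OF this normal[unfolded normal_state_def]] show ?thesis
    by (simp add: o_def)
qed

lemma state_square_diff:
  assumes "a \<in> A" "b \<in> A"
  shows "Re (\<mu> (adj (a - b) * (a - b))) = Re (\<mu> (adj a * a)) - 2 * Re (\<mu> (adj b * a)) + Re (\<mu> (adj b * b))"
  using assms state_hermitian[of a b] by (simp add: left_diff_distrib right_diff_distrib)

lemma state_square_add:
  assumes "a \<in> A" "b \<in> A"
  shows "Re (\<mu> (adj (a + b) * (a + b))) = Re (\<mu> (adj a * a)) + 2 * Re (\<mu> (adj b * a)) + Re (\<mu> (adj b * b))"
  using assms state_hermitian[of a b] by (simp add: distrib_left distrib_right)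

text \<open>Positivity at \<open>a - b\<close> exhibits \<open>\<mu>(a* a)\<close> as a supremum of
  real affine functions of \<open>a\<close>, attained at \<open>b = a\<close>. Each of them is
  \<sigma>-weakly continuous, so sublevel sets become \<sigma>-weakly closed.\<close>

lemma state_square_le_iff:
  assumes "a \<in> A"
  shows "Re (\<mu> (adj a * a)) \<le> t \<longleftrightarrow> (\<forall>b\<in>A. 2 * Re (\<mu> (adj b * a)) \<le> Re (\<mu> (adj b * b)) + t)"
proof
  assume "Re (\<mu> (adj a * a)) \<le> t"
  then have "2 * Re (\<mu> (adj b * a)) \<le> Re (\<mu> (adj b * b)) + t" if "b \<in> A" for b
    using state_square(1)[of "a - b"] state_square_diff[OF assms that] assms that by simp
  then show "\<forall>b\<in>A. 2 * Re (\<mu> (adj b * a)) \<le> Re (\<mu> (adj b * b)) + t"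
    by blast
next
  assume "\<forall>b\<in>A. 2 * Re (\<mu> (adj b * a)) \<le> Re (\<mu> (adj b * b)) + t"
  then have "2 * Re (\<mu> (adj a * a)) \<le> Re (\<mu> (adj a * a)) + t"
    using assms by (rule bspec)
  then show "Re (\<mu> (adj a * a)) \<le> t"
    by simp
qed

section \<open>The centralizer of the state\<close>

definition centralizer :: "'a cblinop set" where
  "centralizer = {a \<in> A. \<forall>b\<in>A. \<mu> (a * b) = \<mu> (b * a)}"

lemma star_subalgebra_centralizer: "star_subalgebra centralizer"
proof -
  have "a * a' \<in> centralizer" if "a \<in> centralizer" "a' \<in> centralizer" for a a'
  proof -
    have A: "a \<in> A" "a' \<in> A"
      using that by (simp_all add: centralizer_def)
    have "\<mu> (a * a' * b) = \<mu> (b * (a * a'))" if "b \<in> A" for b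
    proof -
      have "\<mu> (a * (a' * b)) = \<mu> ((a' * b) * a)"
        using \<open>a \<in> centralizer\<close> A that by (simp only: centralizer_def mem_simps mem_Collect_eq)
      also have "\<dots> = \<mu> (a' * (b * a))"
        by (simp add: mult.assoc)
      also have "\<dots> = \<mu> ((b * a) * a')"
        using \<open>a' \<in> centralizer\<close> A that by (simp only: centralizer_def mem_simps mem_Collect_eq)
      finally show ?thesis
        by (simp add: mult.assoc)
    qed
    then show ?thesis
      using A by (simp add: centralizer_def)
  qed
  moreover have "adj a \<in> centralizer" if "a \<in> centralizer" for a
  proof -
    have A: "a \<in> A"
      using that by (simp add: centralizer_def)
    have "\<mu> (adj a * b) = \<mu> (b * adj a)" if "b \<in> A" for b
    proof -
      have "\<mu> (adj (adj a * b)) = \<mu> (adj (b * adj a))"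
        using \<open>a \<in> centralizer\<close> that by (simp add: centralizer_def)
      then show ?thesis
        using A that by (simp only: state_adj mem_simps complex_cnj_cancel_iff)
    qed
    then show ?thesis
      using A by (simp add: centralizer_def)
  qed
  ultimately show ?thesis
    by (auto simp: star_subalgebra_def centralizer_def distrib_left distrib_right cblinop_scaleC_simps)
qed

text \<open>An element of the bicommutant violating one of the defining equations would violate it
  on a whole \<sigma>-weak neighbourhood, and that neighbourhood meets the centralizer by
  density.\<close>

lemma von_neumann_centralizer: "von_neumann_algebra centralizer"
  unfolding von_neumann_algebra_def
proof (intro conjI)
  show "\<forall>T\<in>centralizer. adj T \<in> centralizer"
    using star_subalgebra_centralizer by (simp add: star_subalgebra_def)
  show "commutant (commutant centralizer) = centralizer"
  proof
    show "centralizer \<subseteq> commutant (commutant centralizer)"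
      by (auto simp: commutant_def)
    show "commutant (commutant centralizer) \<subseteq> centralizer"
    proof
      fix T assume T: "T \<in> commutant (commutant centralizer)"
      have "centralizer \<subseteq> A"
        by (auto simp: centralizer_def)
      then have "T \<in> commutant (commutant A)"
        using T by (auto simp: commutant_def)
      then have TA: "T \<in> A"
        using von_neumann by (simp add: von_neumann_algebra_def)
      have "\<mu> (T * b) = \<mu> (b * T)" if b: "b \<in> A" for b
      proof (rule ccontr)
        assume neq: "\<mu> (T * b) \<noteq> \<mu> (b * T)"
        \<comment> \<open>The unit factors bring both terms into the shape covered by
          \<open>continuous_map_state_mult\<close>.\<close>
        define f where "f = (\<lambda>S. \<mu> (1 * S * b) - \<mu> (b * S * 1))"
        have "continuous_map (subtopology sigma_weak_topology A) euclidean f"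
          unfolding f_def using b by (intro continuous_map_diff continuous_map_state_mult mem_simps)
        from openin_continuous_map_preimage[OF this, of "- {0}"]
        have "openin (subtopology sigma_weak_topology A) {S \<in> A. f S \<noteq> 0}"
          by (simp add: open_Compl)
        then obtain W where W: "openin sigma_weak_topology W" "{S \<in> A. f S \<noteq> 0} = W \<inter> A"
          unfolding openin_subtopology by auto
        have "T \<in> {S \<in> A. f S \<noteq> 0}"
          using TA neq by (simp add: f_def)
        then have "T \<in> W"
          unfolding W(2) by simp
        from bicommutant_sigma_weak_dense[OF star_subalgebra_centralizer T W(1) this]
        obtain S where S: "S \<in> centralizer" "S \<in> W"
          by blast
        then have "S \<in> W \<inter> A"
          by (simp add: centralizer_def)
        then have "f S \<noteq> 0"
          unfolding W(2)[symmetric] by simp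
        moreover have "f S = 0"
          using S(1) b by (simp add: f_def centralizer_def)
        ultimately show False
          by simp
      qed
      then show "T \<in> centralizer"
        using TA by (simp add: centralizer_def)
    qed
  qed
qed

end

section \<open>Invariant functionals of an ergodic action\<close>

locale ergodic_action = faithful_normal_state +
  fixes \<Theta> :: "('a cblinop \<Rightarrow> 'a cblinop) set"
  assumes automorphisms: "\<Theta> \<subseteq> star_automorphisms A"
    and invariant: "\<And>\<theta> a. \<theta> \<in> \<Theta> \<Longrightarrow> a \<in> A \<Longrightarrow> \<mu> (\<theta> a) = \<mu> a"
    and fixed_scalar: "\<And>a. a \<in> A \<Longrightarrow> (\<And>\<theta>. \<theta> \<in> \<Theta> \<Longrightarrow> \<theta> a = a) \<Longrightarrow> \<exists>c. a = c *\<^sub>C 1"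
begin

lemma automorphism_simps:
  assumes "\<theta> \<in> \<Theta>" "a \<in> A"
  shows "\<theta> a \<in> A" "b \<in> A \<Longrightarrow> \<theta> (a * b) = \<theta> a * \<theta> b" "\<theta> (adj a) = adj (\<theta> a)"
  using assms automorphisms star_automorphism_closed[of \<theta> A a]
  by (auto simp: star_automorphisms_def)

lemma invariant_functional_unique:
  assumes \<phi>_add: "\<And>a b. a \<in> A \<Longrightarrow> b \<in> A \<Longrightarrow> \<phi> (a + b) = \<phi> a + \<phi> b"
    and \<phi>_scale: "\<And>c a. a \<in> A \<Longrightarrow> \<phi> (c *\<^sub>C a) = c * \<phi> a"
    and \<phi>_cont: "continuous_map (subtopology sigma_weak_topology A) euclidean \<phi>"
    and \<phi>_inv: "\<And>\<theta> a. \<theta> \<in> \<Theta> \<Longrightarrow> a \<in> A \<Longrightarrow> \<phi> (\<theta> a) = \<phi> a"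
    and a: "a \<in> A"
  shows "\<phi> a = \<phi> 1 * \<mu> a"
proof -
  obtain r where r: "r \<ge> 0" "\<And>x. norm (a *\<^sub>V x) \<le> r * norm x"
    using cblinop_boundE by blast
  define B where "B = {T \<in> A. \<forall>x. norm (T *\<^sub>V x) \<le> r * norm x}"
  define C where "C = {c \<in> B. \<mu> c = \<mu> a \<and> \<phi> c = \<phi> a}"
  define N where "N = (\<lambda>c. Re (\<mu> (adj c * c)))"
  define m where "m = (INF c\<in>C. N c)"
  have aC: "a \<in> C"
    using a r by (simp add: C_def B_def)
  have CA: "c \<in> A" if "c \<in> C" for c
    using that by (simp add: C_def B_def)
  have bdd: "bdd_below (N ` C)"
    by (rule bdd_belowI[of _ 0]) (auto simp: N_def state_square CA)
  have m_le: "m \<le> N c" if "c \<in> C" for c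
    unfolding m_def by (rule cINF_lower[OF bdd that])
  \<comment> \<open>A common point of these nested closed subsets of a compact space is a point at
    which the infimum \<open>m\<close> is attained.\<close>
  define D where "D = (\<lambda>n::nat. {c \<in> C. N c \<le> m + inverse (real (Suc n))})"
  have "(\<Inter>n. D n) \<noteq> {}"
  proof (rule compact_space_imp_nest)
    let ?X = "subtopology sigma_weak_topology B"
    have cont: "continuous_map ?X euclidean f"
      if "continuous_map (subtopology sigma_weak_topology A) euclidean f" for f :: "_ \<Rightarrow> complex"
      by (rule continuous_map_from_subtopology_mono[OF that]) (auto simp: B_def)
    show "compact_space ?X"
      using compactin_sigma_weak_ball[of A r] von_neumann r(1)
      by (simp add: von_neumann_algebra_def compact_space_subtopology B_def)
    show "closedin ?X (D n)" for n
    proof -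
      have half: "closedin euclidean {z. Re z \<le> t}" for t
        unfolding closed_closedin[symmetric] by (intro closed_Collect_le continuous_intros)
      have "closedin ?X {c \<in> topspace ?X. \<mu> c \<in> {\<mu> a}}"
        using normal by (intro closedin_continuous_map_preimage[OF cont]) (simp_all add: normal_state_def)
      moreover have "closedin ?X {c \<in> topspace ?X. \<phi> c \<in> {\<phi> a}}"
        using \<phi>_cont by (intro closedin_continuous_map_preimage[OF cont]) simp_all
      \<comment> \<open>For each \<open>b\<close> this is one of the half-space conditions of
        \<open>state_square_le_iff\<close> with \<open>t = m + inverse (Suc n)\<close>.\<close>
      moreover have "closedin ?X {c \<in> topspace ?X. \<mu> (adj b * c * 1) \<in> {z. Re z \<le> (N b + (m + inverse (real (Suc n)))) / 2}}"
        if "b \<in> A" for b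
        using that by (intro closedin_continuous_map_preimage[OF cont] continuous_map_state_mult mem_simps)
          (rule that half)+
      then have "closedin ?X (\<Inter>b\<in>A. {c \<in> topspace ?X. \<mu> (adj b * c * 1) \<in> {z. Re z \<le> (N b + (m + inverse (real (Suc n)))) / 2}})"
        by (intro closedin_INT) (use mem_simps(1) in blast)+
      ultimately have "closedin ?X ({c \<in> topspace ?X. \<mu> c \<in> {\<mu> a}} \<inter> ({c \<in> topspace ?X. \<phi> c \<in> {\<phi> a}} \<inter>
          (\<Inter>b\<in>A. {c \<in> topspace ?X. \<mu> (adj b * c * 1) \<in> {z. Re z \<le> (N b + (m + inverse (real (Suc n)))) / 2}})))"
        by (intro closedin_Int)
      also have "\<dots> = D n"
      proof -
        have "N c \<le> t \<longleftrightarrow> (\<forall>b\<in>A. Re (\<mu> (adj b * c)) \<le> (N b + t) / 2)" if "c \<in> A" for c t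
          unfolding N_def state_square_le_iff[OF that] by (auto simp: field_simps)
        then show ?thesis
          using mem_simps(1) by (auto simp: D_def C_def B_def)
      qed
      finally show ?thesis .
    qed
    show "D n \<noteq> {}" for n
    proof -
      have "\<exists>c\<in>C. N c < m + inverse (real (Suc n))"
        using cINF_less_iff[OF _ bdd, of "m + inverse (real (Suc n))"] aC
        unfolding m_def[symmetric] by auto
      then show ?thesis
        unfolding D_def by (force intro: less_imp_le)
    qed
    show "decseq D"
    proof (rule decseq_SucI)
      have "inverse (real (Suc (Suc n))) \<le> inverse (real (Suc n))" for n
        by (rule le_imp_inverse_le) simp_all
      then show "D (Suc n) \<subseteq> D n" for n
        unfolding D_def by (auto intro: order_trans add_left_mono)
    qed
  qed
  then obtain c where "\<And>n. c \<in> D n"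
    by blast
  then have c: "c \<in> C" and le: "\<And>n. N c \<le> m + inverse (real (Suc n))"
    unfolding D_def by blast+
  have "(\<lambda>n. m + inverse (real (Suc n))) \<longlonglongrightarrow> m + 0"
    by (intro tendsto_intros LIMSEQ_inverse_real_of_nat)
  then have "N c \<le> m + 0"
    by (rule LIMSEQ_le_const) (use le in blast)
  then have Nc: "N c = m"
    using m_le[OF c] by simp
  have "\<theta> c = c" if \<theta>: "\<theta> \<in> \<Theta>" for \<theta>
  proof -
    define d where "d = \<theta> c"
    have cA: "c \<in> A" and dA: "d \<in> A"
      using CA[OF c] automorphism_simps(1)[OF \<theta>] by (simp_all add: d_def)
    have cb: "norm (c *\<^sub>V x) \<le> r * norm x" for x
      using c by (simp add: C_def B_def)
    have db: "norm (d *\<^sub>V x) \<le> r * norm x" for x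
      unfolding d_def using automorphisms \<theta>
      by (intro star_automorphism_contractive[OF von_neumann _ cA cb r(1)]) auto
    have Nd: "N d = m"
      using invariant[OF \<theta>, of "adj c * c"] cA
      by (simp add: N_def d_def automorphism_simps[OF \<theta>] flip: Nc)
    \<comment> \<open>The midpoint satisfies the constraints of \<open>C\<close>, so
      \<open>N (c + d) \<ge> 4 m\<close>. As \<open>N c = N d = m\<close>, the parallelogram law
      leaves \<open>N (c - d) \<le> 0\<close>, and faithfulness gives \<open>c = d\<close>.\<close>
    define h where "h = (1/2) *\<^sub>C (c + d)"
    have "norm (h *\<^sub>V x) \<le> r * norm x" for x
    proof -
      have "norm (h *\<^sub>V x) \<le> (norm (c *\<^sub>V x) + norm (d *\<^sub>V x)) / 2"
        by (simp add: h_def norm_scaleC norm_triangle_ineq)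
      then show ?thesis
        using cb[of x] db[of x] by simp
    qed
    moreover have "\<mu> h = \<mu> a" "\<phi> h = \<phi> a"
      using c cA dA by (simp_all add: h_def d_def C_def invariant[OF \<theta>] \<phi>_add \<phi>_scale \<phi>_inv[OF \<theta>])
    ultimately have "h \<in> C"
      using cA dA by (simp add: C_def B_def h_def)
    then have "m \<le> N h"
      by (rule m_le)
    also have "N h = N (c + d) / 4"
      using cA dA by (simp add: N_def h_def cblinop_scaleC_simps(2-4))
    finally have "N (c - d) \<le> 0"
      using Nc Nd state_square_diff[OF cA dA] state_square_add[OF cA dA] by (simp add: N_def)
    then have "c - d = 0"
      using cA dA by (intro state_square_le_0) (simp_all add: N_def)
    then show ?thesis
      by (simp add: d_def)
  qed
  then obtain l where l: "c = l *\<^sub>C 1"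
    using fixed_scalar[OF CA[OF c]] by blast
  \<comment> \<open>Evaluating both functionals at \<open>c = l *\<^sub>C 1\<close> gives
    \<open>\<mu> a = l\<close> and \<open>\<phi> a = l * \<phi> 1\<close>.\<close>
  have "\<mu> a = \<mu> c" "\<phi> a = \<phi> c"
    using c by (simp_all add: C_def)
  then show ?thesis
    by (simp add: l \<phi>_scale)
qed

lemma eigenoperator_in_centralizer:
  assumes u: "u \<in> A" "u \<noteq> 0" and eigen: "\<And>\<theta>. \<theta> \<in> \<Theta> \<Longrightarrow> \<exists>c. \<theta> u = c *\<^sub>C u"
  shows "u \<in> centralizer"
proof -
  have nz: "\<mu> (adj u * u) \<noteq> 0"
    using faithful u by (auto simp: faithful_state_def)
  \<comment> \<open>A priori the two eigenvalue factors contribute \<open>cnj c * c\<close>.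
    Invariance of \<open>\<mu>\<close> at \<open>adj u * u\<close>, where it does not vanish, makes
    this product 1.\<close>
  have conj: "\<theta> (adj u * b * u) = adj u * \<theta> b * u" if \<theta>: "\<theta> \<in> \<Theta>" and b: "b \<in> A" for \<theta> b
  proof -
    obtain c where c: "\<theta> u = c *\<^sub>C u"
      using eigen[OF \<theta>] by blast
    have twist: "\<theta> (adj u * b * u) = (cnj c * c) *\<^sub>C (adj u * \<theta> b * u)" if "b \<in> A" for b
      using u that by (simp add: automorphism_simps[OF \<theta>] c cblinop_scaleC_simps mult.commute)
    have "\<theta> 1 = 1"
      using star_automorphism_one[OF von_neumann] automorphisms \<theta> by blast
    then have "\<mu> (adj u * u) = (cnj c * c) * \<mu> (adj u * u)"
      using invariant[OF \<theta>, of "adj u * 1 * u"] twist[of 1] u by simp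
    then have "cnj c * c = 1"
      using nz by simp
    then show ?thesis
      using twist[OF b] by (simp add: cblinop_scaleC_simps)
  qed
  have "\<theta> (adj u * u) = adj u * u" if "\<theta> \<in> \<Theta>" for \<theta>
    using conj[OF that, of 1] star_automorphism_one[OF von_neumann, of \<theta>] automorphisms that by auto
  then obtain p where p: "adj u * u = p *\<^sub>C 1"
    using fixed_scalar[of "adj u * u"] u by auto
  then have "p \<noteq> 0"
    using nz by auto
  have "\<mu> (u * b) = \<mu> (b * u)" if b: "b \<in> A" for b
  proof -
    \<comment> \<open>The left side contains \<open>adj u * u = p\<close>, so it is
      \<open>p \<mu>(b u)\<close>; the factor \<open>\<mu>(adj u * 1 * u)\<close> on the right is
      \<open>p\<close> as well. Cancelling \<open>p\<close> gives the commutation.\<close>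
    have "\<mu> (adj u * (u * b) * u) = \<mu> (adj u * 1 * u) * \<mu> (u * b)"
    proof (rule invariant_functional_unique)
      show "\<mu> (adj u * \<theta> a * u) = \<mu> (adj u * a * u)" if "\<theta> \<in> \<Theta>" "a \<in> A" for \<theta> a
        using invariant[OF that(1), of "adj u * a * u"] conj[OF that] that u by simp
    qed (use u b in \<open>simp_all add: continuous_map_state_mult distrib_left distrib_right cblinop_scaleC_simps\<close>)
    moreover have "adj u * (u * b) * u = p *\<^sub>C (b * u)"
      by (simp add: p cblinop_scaleC_simps flip: mult.assoc)
    ultimately show ?thesis
      using \<open>p \<noteq> 0\<close> u b p by simp
  qed
  then show ?thesis
    using u by (simp add: centralizer_def)
qed

end

section \<open>Spectral measures and the modular group\<close>

lemma sum_i_powers: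
  fixes g :: "complex \<Rightarrow> complex"
  shows "(\<Sum>k<4. \<i> ^ k * g (\<i> ^ k)) = g 1 + \<i> * g \<i> - g (- 1) - \<i> * g (- \<i>)"
proof -
  have "(\<Sum>k<4. f k) = f 0 + f 1 + f 2 + f 3" for f :: "nat \<Rightarrow> complex"
    by (simp add: eval_nat_numeral)
  then show ?thesis
    by (simp add: power3_eq_cube)
qed

lemma complex_polarization:
  "(\<Sum>k<4. \<i> ^ k * complex_of_real ((norm (x + (\<i> ^ k) *\<^sub>C z))\<^sup>2)) / 4 = cinner x (z::'a::chilbert_space)"
proof -
  have "complex_of_real ((norm (x + c *\<^sub>C z))\<^sup>2) =
      cinner x x + cnj c * cinner x z + c * cinner z x + (c * cnj c) * cinner z z" for c
    unfolding cinner_self[symmetric]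
    by (simp add: cinner_add_left cinner_add_right cinner_scaleC_left cinner_scaleC_right algebra_simps)
  then show ?thesis
    unfolding sum_i_powers[where g = "\<lambda>c. complex_of_real ((norm (x + c *\<^sub>C z))\<^sup>2)"]
    by (simp add: algebra_simps)
qed

section \<open>Projection-valued measures\<close>

locale projection_valued =
  fixes E :: "real set \<Rightarrow> 'k::chilbert_space cblinop"
  assumes pvm: "projection_valued_measure E"
begin

lemma pvm_simps:
  assumes "B \<in> sets borel"
  shows "adj (E B) = E B" "C \<in> sets borel \<Longrightarrow> E B *\<^sub>V E C *\<^sub>V x = E (B \<inter> C) *\<^sub>V x" "E UNIV *\<^sub>V x = x"
proof -
  show "adj (E B) = E B" "E UNIV *\<^sub>V x = x"
    using pvm assms by (simp_all add: projection_valued_measure_def)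
  show "E B *\<^sub>V E C *\<^sub>V x = E (B \<inter> C) *\<^sub>V x" if "C \<in> sets borel"
  proof -
    have "E (B \<inter> C) = E B * E C"
      using pvm assms that by (simp add: projection_valued_measure_def)
    then show ?thesis
      by simp
  qed
qed

lemma pvm_sums:
  assumes "range B \<subseteq> sets borel" "disjoint_family B"
  shows "(\<lambda>n. E (B n) *\<^sub>V x) sums (E (\<Union>n. B n) *\<^sub>V x)"
  using pvm assms by (simp add: projection_valued_measure_def)

text \<open>Countably many empty sets form a disjoint family, and a convergent series with constant
  terms has zero terms.\<close>

lemma pvm_empty: "E {} *\<^sub>V x = 0"
proof -
  have "(\<lambda>n::nat. E {} *\<^sub>V x) sums (E {} *\<^sub>V x)"
    using pvm_sums[of "\<lambda>_. {}" x] by (simp add: disjoint_family_on_def)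
  then have "(\<lambda>n::nat. E {} *\<^sub>V x) \<longlonglongrightarrow> 0"
    by (intro summable_LIMSEQ_zero sums_summable)
  then show ?thesis
    by (simp add: LIMSEQ_const_iff)
qed

lemma pvm_Un:
  assumes "B \<in> sets borel" "C \<in> sets borel" "B \<inter> C = {}"
  shows "E (B \<union> C) *\<^sub>V x = E B *\<^sub>V x + E C *\<^sub>V x"
proof -
  have "(\<lambda>n. E (binaryset B C n) *\<^sub>V x) sums (E B *\<^sub>V x + E C *\<^sub>V x)"
    by (rule binaryset_sums) (rule pvm_empty)
  moreover have "(\<lambda>n. E (binaryset B C n) *\<^sub>V x) sums (E (B \<union> C) *\<^sub>V x)"
  proof -
    have "disjoint_family (binaryset B C)"
      unfolding disjoint_family_on_def
    proof (intro ballI impI)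
      fix m n :: nat assume "m \<noteq> n"
      then show "binaryset B C m \<inter> binaryset B C n = {}"
        using assms(3) by (cases "m = 0"; cases "m = 1"; cases "n = 0"; cases "n = 1") (auto simp: binaryset_def)
    qed
    then show ?thesis
      using pvm_sums[of "binaryset B C" x] assms by (simp add: range_binaryset_eq UN_binaryset_eq)
  qed
  ultimately show ?thesis
    by (rule sums_unique2[symmetric])
qed

lemma pvm_Compl: "B \<in> sets borel \<Longrightarrow> E B *\<^sub>V x + E (- B) *\<^sub>V x = x"
  using pvm_Un[of B "- B" x] pvm_simps(3)[of B x] by (simp add: Compl_partition)

lemma cinner_pvm: "B \<in> sets borel \<Longrightarrow> cinner (E B *\<^sub>V x) y = cinner x (E B *\<^sub>V y)"
  by (metis cinner_adj_right pvm_simps(1))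

lemma pvm_self: "B \<in> sets borel \<Longrightarrow> cinner (E B *\<^sub>V x) x = complex_of_real ((norm (E B *\<^sub>V x))\<^sup>2)"
  using cinner_pvm[of B "E B *\<^sub>V x" x] by (simp add: pvm_simps(2) cinner_self)

lemma sets_spectral_measure [simp, measurable_cong]: "sets (spectral_measure E x) = sets borel"
  using sets.sigma_sets_eq[of "borel :: real measure"] by (simp add: spectral_measure_def)

lemma space_spectral_measure [simp]: "space (spectral_measure E x) = UNIV"
  by (simp add: spectral_measure_def)

lemma emeasure_spectral_measure:
  assumes B: "B \<in> sets borel"
  shows "emeasure (spectral_measure E x) B = ennreal ((norm (E B *\<^sub>V x))\<^sup>2)"
proof -
  have "emeasure (spectral_measure E x) B = ennreal (Re (cinner (E B *\<^sub>V x) x))"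
  proof (rule emeasure_measure_of[OF spectral_measure_def])
    show "positive (sets (spectral_measure E x)) (\<lambda>B. ennreal (Re (cinner (E B *\<^sub>V x) x)))"
      by (simp add: positive_def pvm_empty cinner.zero_left)
    show "countably_additive (sets (spectral_measure E x)) (\<lambda>B. ennreal (Re (cinner (E B *\<^sub>V x) x)))"
      unfolding countably_additive_def
    proof (intro allI impI)
      fix C :: "nat \<Rightarrow> real set"
      assume C: "range C \<subseteq> sets (spectral_measure E x)" "disjoint_family C"
      have "(\<lambda>n. Re (cinner (E (C n) *\<^sub>V x) x)) sums Re (cinner (E (\<Union>n. C n) *\<^sub>V x) x)"
        using C by (intro sums_Re bounded_linear.sums[OF cinner.bounded_linear_left] pvm_sums) simp_all
      moreover have "Re (cinner (E (C n) *\<^sub>V x) x) \<ge> 0" for n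
        using C(1) by (subst pvm_self) auto
      ultimately show "(\<Sum>n. ennreal (Re (cinner (E (C n) *\<^sub>V x) x))) = ennreal (Re (cinner (E (\<Union>n. C n) *\<^sub>V x) x))"
        by (intro suminf_ennreal_eq)
    qed
  qed (use B in auto)
  then show ?thesis
    by (simp add: pvm_self[OF B])
qed

lemma finite_spectral_measure: "finite_measure (spectral_measure E x)"
  by (rule finite_measureI) (simp add: emeasure_spectral_measure)

lemma measure_spectral_measure:
  "B \<in> sets borel \<Longrightarrow> measure (spectral_measure E x) B = (norm (E B *\<^sub>V x))\<^sup>2"
  by (simp add: measure_def emeasure_spectral_measure)

text \<open>The vectors of interest arise from \<open>x\<close> by rescaling its part in the range
  of \<open>E B\<close>. Their measures all have step densities with respect to that of
  \<open>x\<close>, so the polarised integrals can be computed over one measure.\<close>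

lemma spectral_measure_eq_density:
  assumes B: "B \<in> sets borel" and pq: "p \<ge> 0" "q \<ge> 0"
    and y: "\<And>C. C \<in> sets borel \<Longrightarrow>
      (norm (E C *\<^sub>V y))\<^sup>2 = p * (norm (E (C \<inter> B) *\<^sub>V x))\<^sup>2 + q * (norm (E (C \<inter> - B) *\<^sub>V x))\<^sup>2"
  shows "spectral_measure E y = density (spectral_measure E x) (\<lambda>s. ennreal (if s \<in> B then p else q))"
proof (rule measure_eqI)
  fix C assume "C \<in> sets (spectral_measure E y)"
  then have C: "C \<in> sets borel"
    by simp
  have "emeasure (density (spectral_measure E x) (\<lambda>s. ennreal (if s \<in> B then p else q))) C =
      (\<integral>\<^sup>+ s. ennreal (if s \<in> B then p else q) * indicator C s \<partial>spectral_measure E x)"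
    using B C by (intro emeasure_density) simp_all
  also have "\<dots> = (\<integral>\<^sup>+ s. ennreal p * indicator (C \<inter> B) s + ennreal q * indicator (C \<inter> - B) s \<partial>spectral_measure E x)"
    by (intro nn_integral_cong) (auto simp: indicator_def)
  also have "\<dots> = ennreal p * emeasure (spectral_measure E x) (C \<inter> B) + ennreal q * emeasure (spectral_measure E x) (C \<inter> - B)"
    using B C by (subst nn_integral_add) (simp_all add: nn_integral_cmult_indicator)
  also have "\<dots> = emeasure (spectral_measure E y) C"
    using B C pq by (simp add: emeasure_spectral_measure y ennreal_mult ennreal_plus)
  finally show "emeasure (spectral_measure E y) C =
      emeasure (density (spectral_measure E x) (\<lambda>s. ennreal (if s \<in> B then p else q))) C" ..
qed simp

lemma norm_pvm_pythagoras:
  assumes "B \<in> sets borel"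
  shows "(norm (a *\<^sub>C (E B *\<^sub>V x) + b *\<^sub>C (E (- B) *\<^sub>V y)))\<^sup>2
    = (cmod a)\<^sup>2 * (norm (E B *\<^sub>V x))\<^sup>2 + (cmod b)\<^sup>2 * (norm (E (- B) *\<^sub>V y))\<^sup>2"
proof -
  have "cinner (E B *\<^sub>V x) (E (- B) *\<^sub>V y) = 0"
    using assms by (simp add: cinner_pvm pvm_simps(2) pvm_empty cinner.zero_right)
  then have "inner (a *\<^sub>C (E B *\<^sub>V x)) (b *\<^sub>C (E (- B) *\<^sub>V y)) = 0"
    by (simp add: inner_eq_Re_cinner cinner_scaleC_left cinner_scaleC_right)
  then show ?thesis
    by (simp add: power2_norm_eq_inner inner_add_left inner_add_right inner_commute)
      (simp add: norm_scaleC power_mult_distrib flip: power2_norm_eq_inner)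
qed

text \<open>Testing \<open>\<Delta> x = x\<close> against \<open>z = E B x\<close> shows that
  \<open>s\<close> and 1 have the same integral over \<open>B\<close> for the measure of
  \<open>x\<close>. As \<open>\<epsilon> * (s - 1)\<close> is positive on \<open>B\<close>, this set
  is null; the sign of \<open>\<epsilon>\<close> selects the side of 1.\<close>

lemma fixed_vector_part_zero:
  assumes fixed: "(x, x) \<in> spectral_integral E complex_of_real"
    and B: "B \<in> sets borel" and \<epsilon>: "\<And>s. s \<in> B \<Longrightarrow> 0 < \<epsilon> * (s - 1)"
  shows "E B *\<^sub>V x = 0"
proof -
  define M where "M = spectral_measure E x"
  define z where "z = E B *\<^sub>V x"
  interpret M: finite_measure M
    unfolding M_def by (rule finite_spectral_measure)
  have setsM [measurable_cong, simp]: "sets M = sets borel"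
    by (simp add: M_def)
  have [measurable]: "B \<in> sets borel"
    by fact
  \<comment> \<open>Adding \<open>c z\<close> multiplies the part of \<open>x\<close> in the range
    of \<open>E B\<close> by \<open>1 + c\<close> and leaves the rest alone.\<close>
  have part: "E C *\<^sub>V (x + c *\<^sub>C z) = (1 + c) *\<^sub>C (E B *\<^sub>V E C *\<^sub>V x) + 1 *\<^sub>C (E (- B) *\<^sub>V E C *\<^sub>V x)"
    if C: "C \<in> sets borel" for C c
  proof -
    have "E C *\<^sub>V x = E B *\<^sub>V E C *\<^sub>V x + E (- B) *\<^sub>V E C *\<^sub>V x"
      using pvm_Compl[OF B, of "E C *\<^sub>V x"] by simp
    moreover have "E C *\<^sub>V z = E B *\<^sub>V E C *\<^sub>V x"
      using B C by (simp add: z_def pvm_simps(2) Int_commute)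
    ultimately show ?thesis
      by (simp add: op_apply_add op_apply_scaleC scaleC_add_left scaleC_one algebra_simps)
  qed
  have split: "spectral_measure E (x + c *\<^sub>C z) = density M (\<lambda>s. ennreal (if s \<in> B then (cmod (1 + c))\<^sup>2 else 1))" for c
    unfolding M_def
  proof (rule spectral_measure_eq_density[OF B])
    fix C :: "real set" assume "C \<in> sets borel"
    then show "(norm (E C *\<^sub>V (x + c *\<^sub>C z)))\<^sup>2 =
        (cmod (1 + c))\<^sup>2 * (norm (E (C \<inter> B) *\<^sub>V x))\<^sup>2 + 1 * (norm (E (C \<inter> - B) *\<^sub>V x))\<^sup>2"
      using B by (simp only: part norm_pvm_pythagoras) (simp add: pvm_simps(2) Int_commute)
  qed simp_all
  have z_density: "spectral_measure E z = density M (\<lambda>s. ennreal (if s \<in> B then 1 else 0))"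
    unfolding M_def
    by (rule spectral_measure_eq_density[OF B]) (use B in \<open>simp_all add: z_def pvm_simps(2)\<close>)
  have sq: "integrable M (\<lambda>s. s\<^sup>2)"
    using fixed by (simp add: spectral_integral_def spectral_domain_def M_def)
  \<comment> \<open>Membership in the domain gives only the second moment; finiteness of
    \<open>M\<close> and \<open>|s| \<le> 1 + s^2\<close> then give the first.\<close>
  have "integrable M (\<lambda>s. 1 + s\<^sup>2)"
    by (intro Bochner_Integration.integrable_add sq) simp
  then have int: "integrable M (\<lambda>s. s)"
  proof (rule Bochner_Integration.integrable_bound)
    have "\<bar>s\<bar> \<le> 1 + s\<^sup>2" for s :: real
      using sum_squares_bound[of 1 "\<bar>s\<bar>"] abs_ge_zero[of s] by (simp add: power2_eq_square[symmetric])
    then show "AE s in M. norm s \<le> norm (1 + s\<^sup>2)"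
      by simp
  qed measurable
  then have intc: "integrable M complex_of_real"
    by simp
  have intB: "integrable M (\<lambda>s. indicat_real B s * s)"
    using int integrable_mult_indicator[of B M "\<lambda>s. s"] by simp
  \<comment> \<open>The graph condition may be tested only against vectors of the domain; the
    measure of \<open>z\<close> is the restriction of \<open>M\<close> to \<open>B\<close>, so the
    second moment remains finite.\<close>
  have "z \<in> spectral_domain E complex_of_real"
  proof -
    have "(\<lambda>s. (if s \<in> B then 1 else 0) *\<^sub>R s\<^sup>2) = (\<lambda>s. indicat_real B s *\<^sub>R s\<^sup>2)"
      by (auto simp: indicator_def)
    then have "integrable M (\<lambda>s. (if s \<in> B then 1 else 0) *\<^sub>R s\<^sup>2)"
      using integrable_mult_indicator[of B M "\<lambda>s. s\<^sup>2"] sq by simp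
    then have "integrable (spectral_measure E z) (\<lambda>s. s\<^sup>2)"
      unfolding z_density by (subst integrable_density) simp_all
    then show ?thesis
      by (simp add: spectral_domain_def)
  qed
  then have form: "cinner x z = spectral_form E complex_of_real x z"
    using fixed by (simp add: spectral_integral_def)
  have lint: "(LINT s|spectral_measure E (x + c *\<^sub>C z). complex_of_real s) =
      ((cmod (1 + c))\<^sup>2 - 1) *\<^sub>R (LINT s|M. complex_of_real (indicat_real B s * s)) + (LINT s|M. complex_of_real s)" for c
  proof -
    have "(LINT s|spectral_measure E (x + c *\<^sub>C z). complex_of_real s) =
        (LINT s|M. (if s \<in> B then (cmod (1 + c))\<^sup>2 else 1) *\<^sub>R complex_of_real s)"
      unfolding split by (rule integral_density) simp_all
    also have "\<dots> = (LINT s|M. ((cmod (1 + c))\<^sup>2 - 1) *\<^sub>R complex_of_real (indicat_real B s * s) + complex_of_real s)"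
      by (intro Bochner_Integration.integral_cong) (auto simp: indicator_def scaleR_conv_of_real algebra_simps)
    also have "\<dots> = ((cmod (1 + c))\<^sup>2 - 1) *\<^sub>R (LINT s|M. complex_of_real (indicat_real B s * s)) + (LINT s|M. complex_of_real s)"
      by (subst Bochner_Integration.integral_add)
        (intro integrable_scaleR_right integrable_of_real intB, rule intc, simp only: integral_scaleR_right)
    finally show ?thesis .
  qed
  \<comment> \<open>For \<open>c = 1, \<i>, -1, -\<i>\<close> the factors
    \<open>(cmod (1 + c))^2 - 1\<close> are 3, 1, -1, 1. Weighted by the same powers of
    \<open>\<i>\<close> they add up to 4, while the common second term cancels.\<close>
  have "spectral_form E complex_of_real x z = (LINT s|M. complex_of_real (indicat_real B s * s))"
    unfolding spectral_form_def sum_i_powers[where g = "\<lambda>c. LINT s|spectral_measure E (x + c *\<^sub>C z). complex_of_real s"]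
    unfolding lint by (simp add: cmod_power2 scaleR_conv_of_real algebra_simps del: of_real_mult)
  also have "\<dots> = complex_of_real (LINT s|M. indicat_real B s * s)"
    by (rule integral_complex_of_real)
  finally have "cinner x z = complex_of_real (LINT s|M. indicat_real B s * s)"
    using form by simp
  moreover have "cinner x z = complex_of_real (LINT s|M. indicat_real B s)"
  proof -
    have "cinner x z = complex_of_real ((norm (E B *\<^sub>V x))\<^sup>2)"
      using pvm_self[OF B, of x] cinner_pvm[OF B, of x x] by (simp add: z_def)
    then show ?thesis
      using B by (simp add: M_def measure_spectral_measure)
  qed
  ultimately have "(LINT s|M. indicat_real B s * s) = (LINT s|M. indicat_real B s)"
    by simp
  moreover have intI: "integrable M (indicat_real B)"
    using B by (intro integrable_real_indicator) (simp_all add: M.emeasure_eq_measure)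
  ultimately have "(LINT s|M. \<epsilon> * (indicat_real B s * s - indicat_real B s)) = 0"
    using intB by simp
  moreover have "integrable M (\<lambda>s. \<epsilon> * (indicat_real B s * s - indicat_real B s))"
    using intB intI by simp
  moreover have "0 \<le> \<epsilon> * (indicat_real B s * s - indicat_real B s)" for s
    using \<epsilon>[of s] by (auto simp: indicator_def intro: less_imp_le)
  ultimately have "AE s in M. \<epsilon> * (indicat_real B s * s - indicat_real B s) = 0"
    by (subst integral_nonneg_eq_0_iff_AE[symmetric]) simp_all
  moreover have "s \<notin> B" if "\<epsilon> * (indicat_real B s * s - indicat_real B s) = 0" for s
    using that \<epsilon>[of s] by (cases "s \<in> B") auto
  ultimately have "AE s in M. s \<notin> B"
    by (rule eventually_mono)
  then have "emeasure M B = 0"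
    using AE_iff_measurable[of B M "\<lambda>s. s \<notin> B"] B by (simp add: M_def)
  then show ?thesis
    using B by (simp add: M_def emeasure_spectral_measure ennreal_eq_0_iff)
qed

lemma fixed_vector_support:
  assumes "(x, x) \<in> spectral_integral E complex_of_real"
  shows "E {1} *\<^sub>V x = x"
proof -
  have "E {1<..} *\<^sub>V x = 0" "E {..<1} *\<^sub>V x = 0"
    using fixed_vector_part_zero[OF assms, of "{1<..}" 1] fixed_vector_part_zero[OF assms, of "{..<1}" "-1"]
    by simp_all
  moreover have "- {1} = {1<..} \<union> {..<1::real}"
    by auto
  moreover have "E ({1<..} \<union> {..<1}) *\<^sub>V x = E {1<..} *\<^sub>V x + E {..<1} *\<^sub>V x"
    by (rule pvm_Un) auto
  ultimately have "E (- {1}) *\<^sub>V x = 0"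
    by simp
  then show ?thesis
    using pvm_Compl[of "{1}" x] by simp
qed

text \<open>The test vector is split by \<open>E {1}\<close>. Along its range every vector involved
  has its measure at 1, where \<open>f = 1\<close>, and polarisation returns the inner product with
  \<open>x\<close>; on the complement both inner products vanish.\<close>

lemma spectral_integral_apply_support_1:
  assumes x: "E {1} *\<^sub>V x = x" and f: "f \<in> borel_measurable borel" "\<And>s. cmod (f s) = 1" "f 1 = 1"
    and y: "(x, y) \<in> spectral_integral E f"
  shows "y = x"
proof (rule cinner_eqI)
  fix z
  have "spectral_domain E f = UNIV"
    using finite_measure.integrable_const[OF finite_spectral_measure] by (auto simp: spectral_domain_def f(2))
  then have form: "cinner y z = spectral_form E f x z" for z
    using y by (auto simp: spectral_integral_def)
  have on: "cinner y z = cinner x z" if z: "E {1} *\<^sub>V z = z" for z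
  proof -
    have "(LINT s|spectral_measure E w. f s) = complex_of_real ((norm w)\<^sup>2)" if w: "E {1} *\<^sub>V w = w" for w
    proof -
      have "E (- {1}) *\<^sub>V w = 0"
        using pvm_Compl[of "{1}" w] w by simp
      then have "emeasure (spectral_measure E w) (- {1}) = 0"
        by (simp add: emeasure_spectral_measure)
      then have "AE s in spectral_measure E w. s = 1"
        by (intro AE_I[of _ _ "- {1}"]) auto
      then have "(LINT s|spectral_measure E w. f s) = (LINT s|spectral_measure E w. 1)"
        using f by (intro integral_cong_AE) auto
      also have "\<dots> = complex_of_real ((norm w)\<^sup>2)"
        by (simp add: measure_spectral_measure pvm_simps(3)[of "{}"] scaleR_conv_of_real)
      finally show ?thesis .
    qed
    moreover have "E {1} *\<^sub>V (x + c *\<^sub>C z) = x + c *\<^sub>C z" for c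
      by (simp add: op_apply_add op_apply_scaleC x z)
    ultimately have "spectral_form E f x z = cinner x z"
      unfolding spectral_form_def complex_polarization[symmetric] by simp
    then show ?thesis
      by (simp add: form)
  qed
  \<comment> \<open>The parts \<open>x\<close> and \<open>z\<close> have disjoint spectral support,
    so all four vectors \<open>x + \<i>^k z\<close> have the same measure, and the sum of the powers
    of \<open>\<i>\<close> cancels the integral.\<close>
  have off: "cinner y z = cinner x z" if z: "E {1} *\<^sub>V z = 0" for z
  proof -
    have z': "E (- {1}) *\<^sub>V z = z"
      using pvm_Compl[of "{1}" z] z by simp
    have "(norm (E C *\<^sub>V (x + c *\<^sub>C z)))\<^sup>2 = (norm (E C *\<^sub>V (x + 1 *\<^sub>C z)))\<^sup>2"
      if "cmod c = 1" "C \<in> sets borel" for c C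
    proof -
      have "E C *\<^sub>V (x + d *\<^sub>C z) = 1 *\<^sub>C (E {1} *\<^sub>V E C *\<^sub>V x) + d *\<^sub>C (E (- {1}) *\<^sub>V E C *\<^sub>V z)" for d
      proof -
        have "E C *\<^sub>V (x + d *\<^sub>C z) = E C *\<^sub>V (E {1} *\<^sub>V x + d *\<^sub>C (E (- {1}) *\<^sub>V z))"
          by (simp only: x z')
        then show ?thesis
          using that(2) by (simp add: op_apply_add op_apply_scaleC pvm_simps(2) Int_commute scaleC_one)
      qed
      then show ?thesis
        using that(1) by (simp add: norm_pvm_pythagoras)
    qed
    moreover define M where "M = spectral_measure E (x + 1 *\<^sub>C z)"
    ultimately have "spectral_measure E (x + c *\<^sub>C z) = M" if "cmod c = 1" for c
      unfolding M_def using that by (intro measure_eqI) (simp_all only: sets_spectral_measure emeasure_spectral_measure)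
    then have "spectral_form E f x z = (\<Sum>k<4. \<i> ^ k * (LINT s|M. f s)) / 4"
      unfolding spectral_form_def by (simp add: norm_power)
    also have "\<dots> = 0"
      using sum_i_powers[of "\<lambda>_. LINT s|M. f s"] by simp
    finally have "cinner y z = 0"
      by (simp add: form)
    moreover have "cinner x z = 0"
      using cinner_pvm[of "{1}" x z] by (simp add: x z cinner.zero_right)
    ultimately show ?thesis
      by simp
  qed
  have "cinner w z = cinner w (E {1} *\<^sub>V z) + cinner w (E (- {1}) *\<^sub>V z)" for w
    by (simp add: pvm_Compl flip: cinner_add_right)
  moreover have "cinner y (E {1} *\<^sub>V z) = cinner x (E {1} *\<^sub>V z)"
    by (rule on) (simp add: pvm_simps(2))
  moreover have "cinner y (E (- {1}) *\<^sub>V z) = cinner x (E (- {1}) *\<^sub>V z)"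
    by (rule off) (simp add: pvm_simps(2) pvm_empty)
  ultimately show "cinner y z = cinner x z"
    by simp
qed

end

lemma imaginary_powers_fixed_vector:
  assumes "imaginary_powers D U" "(x, x) \<in> D"
  shows "U t *\<^sub>V x = x"
proof -
  obtain E where E: "projection_valued_measure E" "spectral_integral E complex_of_real = D"
    and U: "\<And>t. spectral_integral E (\<lambda>s. cis (t * ln s)) = {(x, U t *\<^sub>V x) | x. True}"
    using assms(1) unfolding imaginary_powers_def by blast
  interpret projection_valued E
    by standard (rule E)
  show ?thesis
  proof (rule spectral_integral_apply_support_1)
    show "E {1} *\<^sub>V x = x"
      using assms(2) by (intro fixed_vector_support) (simp add: E(2))
    show "(x, U t *\<^sub>V x) \<in> spectral_integral E (\<lambda>s. cis (t * ln s))"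
      unfolding U by blast
    show "(\<lambda>s. cis (t * ln s)) \<in> borel_measurable borel"
      unfolding cis_conv_exp by measurable
  qed simp_all
qed

section \<open>The modular group on the centralizer\<close>

context faithful_normal_state
begin

text \<open>\<open>S\<close> sends \<open>\<pi> a \<Omega>\<close> to
  \<open>\<pi> (adj a) \<Omega>\<close>. The adjoint of \<open>S\<close> sends it back, since on the
  vectors \<open>\<pi> b \<Omega>\<close> this amounts to
  \<open>\<mu> (a * adj b) = \<mu> (adj b * a)\<close>.\<close>

lemma centralizer_modular_operator:
  assumes gns: "gns_representation A \<mu> \<pi> \<Omega>" and a: "a \<in> centralizer"
  shows "(\<pi> a *\<^sub>V \<Omega>, \<pi> a *\<^sub>V \<Omega>) \<in> modular_operator A \<pi> \<Omega>"
proof -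
  have aA: "a \<in> A"
    using a by (simp add: centralizer_def)
  have hom: "\<pi> (b * c) = \<pi> b * \<pi> c" "\<pi> (adj b) = adj (\<pi> b)" "cinner (\<pi> b *\<^sub>V \<Omega>) \<Omega> = \<mu> b"
    if "b \<in> A" "c \<in> A" for b c
    using gns that by (simp_all add: gns_representation_def)
  have gns_inner: "cinner (\<pi> b *\<^sub>V \<Omega>) (\<pi> c *\<^sub>V \<Omega>) = \<mu> (adj c * b)" if "b \<in> A" "c \<in> A" for b c
    using that hom(3)[of "adj c * b" 1] by (simp add: hom cinner_adj_left)
  define S where "S = tomita_operator A \<pi> \<Omega>"
  have "(\<pi> a *\<^sub>V \<Omega>, \<pi> (adj a) *\<^sub>V \<Omega>) \<in> {(\<pi> a *\<^sub>V \<Omega>, \<pi> (adj a) *\<^sub>V \<Omega>) | a. a \<in> A}"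
    using aA by blast
  then have in_S: "(\<pi> a *\<^sub>V \<Omega>, \<pi> (adj a) *\<^sub>V \<Omega>) \<in> S"
    unfolding S_def tomita_operator_def by (rule closure_subset[THEN subsetD])
  \<comment> \<open>The adjoint relation must hold on the closed graph of \<open>S\<close>. It is a
    closed condition, so the vectors coming from \<open>A\<close> suffice.\<close>
  define R where "R = {p. cinner (snd p) (\<pi> (adj a) *\<^sub>V \<Omega>) = cinner (\<pi> a *\<^sub>V \<Omega>) (fst p)}"
  have "closed R"
    unfolding R_def
    by (intro closed_Collect_eq cinner.continuous_on continuous_intros)
  moreover have "(\<pi> b *\<^sub>V \<Omega>, \<pi> (adj b) *\<^sub>V \<Omega>) \<in> R" if b: "b \<in> A" for b
    using a aA b by (simp add: R_def gns_inner) (simp add: centralizer_def)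
  then have "{(\<pi> a *\<^sub>V \<Omega>, \<pi> (adj a) *\<^sub>V \<Omega>) | a. a \<in> A} \<subseteq> R"
    by blast
  ultimately have "S \<subseteq> R"
    unfolding S_def tomita_operator_def by (intro closure_minimal)
  then have "(\<pi> (adj a) *\<^sub>V \<Omega>, \<pi> a *\<^sub>V \<Omega>) \<in> antilinear_adjoint S"
    by (auto simp: antilinear_adjoint_def R_def)
  with in_S show ?thesis
    unfolding modular_operator_def S_def[symmetric] by (rule relcompI)
qed

lemma centralizer_modular_fixed:
  assumes \<sigma>: "modular_group A \<mu> \<pi> \<Omega> \<sigma>" and a: "a \<in> centralizer"
  shows "\<sigma> t a = a"
proof -
  have gns: "gns_representation A \<mu> \<pi> \<Omega>"
    using \<sigma> by (simp add: modular_group_def)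
  obtain U where U: "imaginary_powers (modular_operator A \<pi> \<Omega>) U"
    and \<sigma>U: "\<And>t a. a \<in> A \<Longrightarrow> \<sigma> t a \<in> A \<and> \<pi> (\<sigma> t a) = U t * \<pi> a * U (- t)"
    using \<sigma> unfolding modular_group_def by blast
  have aA: "a \<in> A"
    using a by (simp add: centralizer_def)
  have fixed: "U t *\<^sub>V \<pi> b *\<^sub>V \<Omega> = \<pi> b *\<^sub>V \<Omega>" if "b \<in> centralizer" for b t
    by (rule imaginary_powers_fixed_vector[OF U centralizer_modular_operator[OF gns that]])
  have "\<pi> 1 = 1"
    using gns by (simp add: gns_representation_def)
  moreover have "1 \<in> centralizer"
    by (simp add: centralizer_def)
  ultimately have "U (- t) *\<^sub>V \<Omega> = \<Omega>"
    using fixed[of 1 "- t"] by simp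
  then have \<sigma>a: "\<pi> (\<sigma> t a) *\<^sub>V \<Omega> = \<pi> a *\<^sub>V \<Omega>"
    using \<sigma>U[OF aA, of t] fixed[OF a] by simp
  define d where "d = \<sigma> t a - a"
  have dA: "d \<in> A"
    using \<sigma>U[OF aA, of t] aA by (simp add: d_def)
  \<comment> \<open>The GNS conditions give additivity, so the difference is reached through
    \<open>d + a = \<sigma> t a\<close>.\<close>
  have "\<pi> (d + a) = \<pi> d + \<pi> a"
    using gns dA aA by (simp add: gns_representation_def)
  then have "\<pi> d *\<^sub>V \<Omega> = 0"
    using \<sigma>a by (simp add: d_def)
  moreover have "\<mu> (adj d * d) = cinner (\<pi> (adj d * d) *\<^sub>V \<Omega>) \<Omega>" "\<pi> (adj d * d) = \<pi> (adj d) * \<pi> d"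
    using gns dA by (simp_all add: gns_representation_def)
  ultimately have "\<mu> (adj d * d) = 0"
    by (simp add: op_apply_0 cinner.zero_left)
  then show ?thesis
    using state_square_le_0[OF dA] by (simp add: d_def)
qed

end

section \<open>The algebra generated by the eigenoperators\<close>

lemma von_neumann_algebra_Inter:
  assumes "\<And>N. N \<in> \<N> \<Longrightarrow> von_neumann_algebra N"
  shows "von_neumann_algebra (\<Inter>\<N>)"
  unfolding von_neumann_algebra_def
proof (intro conjI)
  show "\<forall>T\<in>\<Inter>\<N>. adj T \<in> \<Inter>\<N>"
    using assms by (auto simp: von_neumann_algebra_def)
  show "commutant (commutant (\<Inter>\<N>)) = \<Inter>\<N>"
  proof
    have "commutant (commutant (\<Inter>\<N>)) \<subseteq> N" if "N \<in> \<N>" for N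
    proof -
      have "commutant (commutant (\<Inter>\<N>)) \<subseteq> commutant (commutant N)"
        using that by (fastforce simp: commutant_def)
      then show ?thesis
        using assms[OF that] by (simp add: von_neumann_algebra_def)
    qed
    then show "commutant (commutant (\<Inter>\<N>)) \<subseteq> \<Inter>\<N>"
      by blast
  qed (auto simp: commutant_def)
qed

theorem theorem6p1:
  fixes G :: "('g, 'm) monoid_scheme"
    and A :: "'h::chilbert_space cblinop set"
    and \<mu> :: "'h cblinop \<Rightarrow> complex"
    and \<alpha> :: "'g \<Rightarrow> 'h cblinop \<Rightarrow> 'h cblinop"
  assumes "group G" and "system G A \<mu> \<alpha>" and "ergodic G A \<alpha>"
  shows "(\<forall>(\<pi> :: 'h cblinop \<Rightarrow> 'k::chilbert_space cblinop) \<Omega> \<sigma>.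
            modular_group A \<mu> \<pi> \<Omega> \<sigma> \<longrightarrow>
            eigenoperator_algebra G A \<alpha> \<subseteq> fixed_point_algebra (UNIV :: real set) A \<sigma>) \<and>
         tracial_state (eigenoperator_algebra G A \<alpha>) \<mu> \<and>
         finite_von_neumann_algebra (eigenoperator_algebra G A \<alpha>)"
proof -
  \<comment> \<open>Invariance, fixed points and eigenoperators are conditions on each automorphism
    separately, so the action enters through the set of its automorphisms.\<close>
  interpret ergodic_action A \<mu> "\<alpha> ` carrier G"
  proof
    show "\<alpha> ` carrier G \<subseteq> star_automorphisms A"
      using assms(2) by (auto simp: system_def star_aut_group_def hom_def)
    show "\<exists>c. a = c *\<^sub>C 1" if "a \<in> A" "\<And>\<theta>. \<theta> \<in> \<alpha> ` carrier G \<Longrightarrow> \<theta> a = a" for a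
    proof -
      have "a \<in> fixed_point_algebra (carrier G) A \<alpha>"
        using that by (simp add: fixed_point_algebra_def)
      then show ?thesis
        using assms(3) by (auto simp: ergodic_def)
    qed
  qed (use assms(2) in \<open>auto simp: system_def\<close>)
  let ?K = "eigenoperator_algebra G A \<alpha>"
  have "eigenoperators G A \<alpha> \<subseteq> centralizer"
    by (auto simp: eigenoperators_def intro!: eigenoperator_in_centralizer)
  \<comment> \<open>The centralizer is itself one of the algebras whose intersection is
    \<open>?K\<close>.\<close>
  then have K: "?K \<subseteq> centralizer"
    unfolding eigenoperator_algebra_def generated_von_neumann_algebra_def
    using von_neumann_centralizer by (intro Inter_lower) (auto simp: centralizer_def)
  then have KA: "?K \<subseteq> A"
    by (auto simp: centralizer_def)
  have vn: "von_neumann_algebra ?K"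
    unfolding eigenoperator_algebra_def generated_von_neumann_algebra_def
    by (rule von_neumann_algebra_Inter) simp
  have "?K \<subseteq> fixed_point_algebra (UNIV :: real set) A \<sigma>" if "modular_group A \<mu> \<pi> \<Omega> \<sigma>"
    for \<pi> :: "'h cblinop \<Rightarrow> 'k cblinop" and \<Omega> \<sigma>
    using K KA centralizer_modular_fixed[OF that] by (auto simp: fixed_point_algebra_def)
  moreover have "tracial_state ?K \<mu>"
    unfolding tracial_state_def
  proof (intro conjI ballI)
    show "state ?K \<mu>"
      using state KA unfolding state_def by blast
    show "\<mu> (a * b) = \<mu> (b * a)" if "a \<in> ?K" "b \<in> ?K" for a b
      using that K KA by (auto simp: centralizer_def)
  qed
  moreover have "v * adj v = 1" if v: "v \<in> ?K" "adj v * v = 1" for v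
  proof -
    have vA: "v \<in> A" and comm: "\<mu> (v * adj v) = \<mu> (adj v * v)"
      using v(1) K KA by (auto simp: centralizer_def)
    \<comment> \<open>\<open>1 - v * adj v\<close> is a projection, hence its own absolute square;
      its state is 0 by the trace property, so faithfulness makes it vanish.\<close>
    have "adj (1 - v * adj v) * (1 - v * adj v) = 1 - v * adj v"
    proof -
      have "v * (adj v * v) * adj v = v * adj v"
        by (simp add: v(2))
      then show ?thesis
        by (simp add: left_diff_distrib right_diff_distrib mult.assoc)
    qed
    then have "\<mu> (adj (1 - v * adj v) * (1 - v * adj v)) = 0"
      using vA comm v(2) by simp
    then have "1 - v * adj v = 0"
      using vA by (intro state_square_le_0) simp_all
    then show ?thesis
      by simp
  qed
  ultimately show ?thesis
    using vn by (simp add: finite_von_neumann_algebra_def)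
qed

end
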